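(* Let $0<p<q<\infty$ and let $X$ be a nonnegative random variable which is both $\{p,q\}$-min-hypercontractive and $\{p,q\}$-max-hypercontractive. Then there exists a constant $D$ such that for all $l\ge 1$ and all positive integers $n_1,k_1,n_2,k_2,\dots,n_l,k_l$, $$\|M_{n_1}m_{k_1}M_{n_2}m_{k_2}\cdots M_{n_l}m_{k_l}(X)\|_q\le D\,\|M_{n_1}m_{k_1}M_{n_2}m_{k_2}\cdots M_{n_l}m_{k_l}(X)\|_p .$$
   Context: $\|W\|_r=(E|W|^r)^{1/r}$. For a nonnegative random variable $W$, $m_n(W)$ and $M_n(W)$ denote (in distribution) the minimum and the maximum of $n$ i.i.d. copies of $W$; compositions are applied from right to left, with fresh independent copies at each stage (e.g. $M_nm_k(X)=\max_{i\le n}\min_{j\le k}X_{i,j}$ with $X_{i,j}$ i.i.d. copies of $X$). A nonnegative random variable $W$ with $EW^q<\infty$ is $\{p,q\}$-min-hypercontractive if there is a constant $C$ with $\|m_n(W)\|_q\le C\|m_n(W)\|_p$ for all $n\ge1$, and $\{p,q\}$-max-hypercontractive if there is a constant $C$ with $\|M_n(W)\|_q\le C\|M_n(W)\|_p$ for all $n\ge 1$. *)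

theory Defs
  imports "HOL-Probability.Probability"
begin

text \<open>
  The operations \<open>m\<^sub>n\<close> and \<open>M\<^sub>n\<close> are only determined in distribution, so they act on laws
  (Borel probability measures on the real line). Iterating them gives fresh independent copies
  at every stage, because each step takes a product measure. They are meaningful for \<open>n \<ge> 1\<close> only.
\<close>

definition min_law :: "nat \<Rightarrow> real measure \<Rightarrow> real measure" where
  "min_law n \<mu> = distr (\<Pi>\<^sub>M i\<in>{..<n}. \<mu>) borel (\<lambda>x. MIN i\<in>{..<n}. x i)"

definition max_law :: "nat \<Rightarrow> real measure \<Rightarrow> real measure" where
  "max_law n \<mu> = distr (\<Pi>\<^sub>M i\<in>{..<n}. \<mu>) borel (\<lambda>x. MAX i\<in>{..<n}. x i)"

text \<open>
  \<open>maxmin_law [(n\<^sub>1, k\<^sub>1), \<dots>, (n\<^sub>l, k\<^sub>l)]\<close> is \<open>M\<^bsub>n\<^sub>1\<^esub> m\<^bsub>k\<^sub>1\<^esub> \<cdots> M\<^bsub>n\<^sub>l\<^esub> m\<^bsub>k\<^sub>l\<^esub>\<close>;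
  the operator \<open>m\<^bsub>k\<^sub>l\<^esub>\<close> is applied first.
\<close>

definition maxmin_law :: "(nat \<times> nat) list \<Rightarrow> real measure \<Rightarrow> real measure" where
  "maxmin_law nks \<mu> = foldr (\<lambda>(n, k) \<nu>. max_law n (min_law k \<nu>)) nks \<mu>"

text \<open>
  \<open>\<parallel>W\<parallel>\<^sub>r\<close> for \<open>W\<close> of law \<open>\<mu>\<close>. The Bochner integral is \<open>0\<close> when the moment is infinite; this never
  matters for \<open>0 < r \<le> q\<close> and \<open>E W\<^sup>q < \<infinity>\<close>, since for \<open>n \<ge> 1\<close> a minimum or maximum of \<open>n\<close>
  copies is bounded in absolute value by the sum of the absolute values of the copies.
\<close>

definition law_norm :: "real \<Rightarrow> real measure \<Rightarrow> real" where
  "law_norm r \<mu> = (\<integral>x. \<bar>x\<bar> powr r \<partial>\<mu>) powr (1 / r)"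

definition min_hypercontractive :: "real \<Rightarrow> real \<Rightarrow> real measure \<Rightarrow> bool" where
  "min_hypercontractive p q \<mu> \<longleftrightarrow>
     (AE x in \<mu>. 0 \<le> x) \<and> integrable \<mu> (\<lambda>x. x powr q) \<and>
     (\<exists>C::real. \<forall>n\<ge>1. law_norm q (min_law n \<mu>) \<le> C * law_norm p (min_law n \<mu>))"

definition max_hypercontractive :: "real \<Rightarrow> real \<Rightarrow> real measure \<Rightarrow> bool" where
  "max_hypercontractive p q \<mu> \<longleftrightarrow>
     (AE x in \<mu>. 0 \<le> x) \<and> integrable \<mu> (\<lambda>x. x powr q) \<and>
     (\<exists>C::real. \<forall>n\<ge>1. law_norm q (max_law n \<mu>) \<le> C * law_norm p (max_law n \<mu>))"

end

theory Submission
  imports Defs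
begin

text \<open>
  The idea is to find a scaling factor \<open>s > 0\<close> such that replacing each independent copy \<open>X\<^sub>i\<close> by \<open>s X\<^sub>i\<close>
  pays for the passage from the norm of exponent \<open>p\<close> to that of exponent \<open>q\<close>:
  \<open>\<parallel>h(s X\<^sub>1, s X\<^sub>2, \<dots>)\<parallel>\<^sub>q \<le> \<parallel>h(X\<^sub>1, X\<^sub>2, \<dots>)\<parallel>\<^sub>p\<close> for every function \<open>h\<close> built from maxima and minima. Such an
  \<open>h\<close> is positively homogeneous, so the left side is \<open>s \<parallel>h(X\<^sub>1, X\<^sub>2, \<dots>)\<parallel>\<^sub>q\<close> and \<open>D = 1 / s\<close> works.

  As a function of one variable alone, \<open>h\<close> is a two-sided truncation \<open>x \<mapsto> a \<or> (b \<and> x)\<close>. A law is called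
  \<open>truncation_contractive\<close> if the displayed inequality holds for these functions of one variable.
  Minkowski's integral inequality, available because \<open>p \<le> q\<close>, lets the variables be treated one after
  the other, so that the property passes, with the same \<open>s\<close>, to the maximum and the minimum of two
  independent variables (\<open>truncation_contractive_pair_law\<close>), and hence to all laws obtained by iteration
  (\<open>maxmin_law_preserves\<close>). Removing the truncation at the end yields the comparison of norms
  (\<open>law_norm_le_of_truncation_contractive\<close>).

  It remains to find \<open>s\<close> for the law of \<open>X\<close> itself. A truncation is compared with a level \<open>u\<close> between \<open>a\<close> and
  \<open>b\<close>: its excess above \<open>u\<close> and its deficit below \<open>u\<close> can be estimated separately, and Bernoulli's inequality
  combines the two estimates (\<open>truncation_contractive_of_tails\<close>). For the excess it suffices that the part
  of \<open>E (s X)\<^sup>q\<close> where \<open>s X > u\<close> is a small multiple of \<open>u\<^sup>q P (X \<ge> 2 u)\<close>; for the deficit, that \<open>P (X < u)\<close> is a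
  small multiple of \<open>P (s X \<le> u / 2)\<close>. The first is a statement about large values and follows from
  max-hypercontractivity (\<open>max_hypercontractive_upper_tail\<close>); the second is one about small values and
  follows from min-hypercontractivity (\<open>min_hypercontractive_lower_tail\<close>). In both cases the norms of extrema
  of \<open>n\<close> copies locate, by Markov's and Paley--Zygmund's inequalities, the points where the tail of \<open>X\<close>
  has size of order \<open>1 / n\<close>.
\<close>

section \<open>Convexity and Minkowski's integral inequality\<close>

lemma powr_above_tangent:
  fixes m z r :: real
  assumes "1 \<le> r" "0 < m" "0 < z"
  shows "m powr r + r * m powr (r - 1) * (z - m) \<le> z powr r"
proof -
  have "r * m powr (r - 1) * (z - m) \<le> z powr r - m powr r"
  proof (rule convex_on_imp_above_tangent[of "{0<..}" "\<lambda>x. x powr r"])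
    show "convex_on {0<..} (\<lambda>x::real. x powr r)"
      using powr_convex[of r] assms by simp
    show "((\<lambda>x. x powr r) has_real_derivative r * m powr (r - 1)) (at m within {0<..})"
      using assms by (auto intro!: derivative_eq_intros)
  qed (use assms in \<open>auto simp: interior_open\<close>)
  then show ?thesis by simp
qed

lemma (in prob_space) integral_between:
  fixes f :: "'a \<Rightarrow> real"
  assumes "f \<in> borel_measurable M" "\<And>x. x \<in> space M \<Longrightarrow> a \<le> f x" "\<And>x. x \<in> space M \<Longrightarrow> f x \<le> b"
  shows "a \<le> (\<integral>x. f x \<partial>M)" "(\<integral>x. f x \<partial>M) \<le> b" "integrable M f"
proof -
  have "\<bar>f x\<bar> \<le> max \<bar>a\<bar> \<bar>b\<bar>" if "x \<in> space M" for x
    using assms(2,3)[of x] that by auto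
  then show I: "integrable M f"
    using assms(1) by (intro integrable_const_bound[where B = "max \<bar>a\<bar> \<bar>b\<bar>"]) auto
  show "a \<le> (\<integral>x. f x \<partial>M)"
    using integral_ge_const[OF I, of a] assms(2) by auto
  show "(\<integral>x. f x \<partial>M) \<le> b"
    using integral_le_const[OF I, of b] assms(3) by auto
qed

lemma (in finite_measure) integrable_mult_indicator_const:
  fixes c :: real
  assumes "A \<in> sets M"
  shows "integrable M (\<lambda>x. c * indicator A x)"
  using assms by (intro integrable_mult_right integrable_real_indicator) (auto simp: less_top[symmetric])

text \<open>
Write \<open>k x\<close> for the norm \<open>(\<integral>y. h x y powr r \<partial>M2) powr (1/r)\<close>. After the substitution \<open>h = k \<cdot> (h / k)\<close>
the inner integral over \<open>x\<close> becomes an average of \<open>h / k\<close> for the probability density \<open>k / \<integral>k\<close>.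
Convexity of the power, in the form of a tangent line at the average, moves the power inside; the
integral over \<open>y\<close> of \<open>(h x y / k x) powr r\<close> is then \<open>1\<close> for every \<open>x\<close>. Bounding \<open>h\<close> away from \<open>0\<close>
and \<open>\<infinity>\<close> makes every integral finite and every division legitimate.
\<close>

lemma Minkowski_integral_inequality:
  fixes h :: "'a \<Rightarrow> 'b \<Rightarrow> real"
  assumes M1: "prob_space M1" and M2: "prob_space M2"
    and [measurable]: "case_prod h \<in> borel_measurable (M1 \<Otimes>\<^sub>M M2)"
    and lo: "0 < lo" "\<And>x y. lo \<le> h x y" and hi: "\<And>x y. h x y \<le> hi"
    and r: "1 \<le> r"
  shows "(\<integral>y. (\<integral>x. h x y \<partial>M1) powr r \<partial>M2) \<le> (\<integral>x. (\<integral>y. h x y powr r \<partial>M2) powr (1/r) \<partial>M1) powr r"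
proof -
  interpret M1: prob_space M1 by fact
  interpret M2: prob_space M2 by fact
  interpret pair_prob_space M1 M2 ..
  have hp: "0 < h x y" for x y using lo(1) lo(2)[of x y] by linarith
  define k where "k = (\<lambda>x. (\<integral>y. h x y powr r \<partial>M2) powr (1/r))"
  define K where "K = (\<integral>x. k x \<partial>M1)"
  define G where "G = (\<lambda>y. \<integral>x. h x y \<partial>M1)"
  have [measurable]: "k \<in> borel_measurable M1" "G \<in> borel_measurable M2"
    unfolding k_def G_def by measurable
  have hm1: "(\<lambda>x. h x y) \<in> borel_measurable M1" if "y \<in> space M2" for y
    using that by measurable
  have hm2: "(\<lambda>y. h x y) \<in> borel_measurable M2" if "x \<in> space M1" for x
    using that by measurable
  have hr: "lo powr r \<le> h x y powr r" "h x y powr r \<le> hi powr r" for x y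
    using lo hi hp[of x y] r by (auto intro!: powr_mono2 simp: less_imp_le)
  have Ihr: "lo powr r \<le> (\<integral>y. h x y powr r \<partial>M2)" "(\<integral>y. h x y powr r \<partial>M2) \<le> hi powr r"
    if "x \<in> space M1" for x
    using M2.integral_between(1,2)[of "\<lambda>y. h x y powr r" "lo powr r" "hi powr r"] hm2[OF that] hr by auto
  have hi0: "0 < hi" using lo hi order_trans by (meson less_le_trans)
  have k: "lo \<le> k x" "k x \<le> hi" if "x \<in> space M1" for x
  proof -
    have "(lo powr r) powr (1/r) \<le> k x" "k x \<le> (hi powr r) powr (1/r)"
      unfolding k_def using Ihr[OF that] r
      by (auto intro!: powr_mono2)
    then show "lo \<le> k x" "k x \<le> hi"
      using lo hi0 r by (auto simp: powr_powr)
  qed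
  have kr: "k x powr r = (\<integral>y. h x y powr r \<partial>M2)" if "x \<in> space M1" for x
    using Ihr[OF that] r unfolding k_def
    by (simp add: powr_powr)
  have K: "lo \<le> K" "K \<le> hi" "integrable M1 k"
    unfolding K_def by (rule M1.integral_between[of k lo hi]; use k in simp)+
  have G: "lo \<le> G y" "G y \<le> hi" "integrable M1 (\<lambda>x. h x y)" if "y \<in> space M2" for y
    using M1.integral_between[of "\<lambda>x. h x y" lo hi] hm1[OF that] lo hi unfolding G_def by auto
  \<comment> \<open>the integrand \<open>k x * (h x y / k x) powr r\<close>\<close>
  define F where "F = (\<lambda>x y. k x powr (1 - r) * h x y powr r)"
  have [measurable]: "case_prod F \<in> borel_measurable (M1 \<Otimes>\<^sub>M M2)"
    unfolding F_def by measurable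
  have F: "0 \<le> F x y" "F x y \<le> lo powr (1 - r) * hi powr r" if "x \<in> space M1" for x y
  proof -
    have "k x powr (1 - r) \<le> lo powr (1 - r)"
      using k[OF that] lo r by (intro powr_mono2') auto
    then show "0 \<le> F x y" "F x y \<le> lo powr (1 - r) * hi powr r"
      unfolding F_def using hr[of x y] by (auto intro!: mult_mono)
  qed
  have pt: "K * (G y / K) powr r \<le> (\<integral>x. F x y \<partial>M1)" if y: "y \<in> space M2" for y
  proof -
    define m where "m = G y / K"
    have m: "0 < m" using G[OF y] K lo by (simp add: m_def)
    have IF: "integrable M1 (\<lambda>x. F x y)"
      by (rule M1.integral_between(3)[where a = 0]) (use F y hm1[OF y] in \<open>auto simp: F_def\<close>)
    have "k x * m powr r + r * m powr (r - 1) * (h x y - m * k x) \<le> F x y" if "x \<in> space M1" for x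
    proof -
      have kx: "0 < k x" using k[OF that] lo by linarith
      have "k x * (m powr r + r * m powr (r - 1) * (h x y / k x - m)) \<le> k x * (h x y / k x) powr r"
        using powr_above_tangent[of r m "h x y / k x"] r m kx hp[of x y]
        by (intro mult_left_mono) auto
      also have "k x * (h x y / k x) powr r = F x y"
        using kx hp[of x y] by (simp add: F_def powr_divide powr_diff)
      also have "k x * (m powr r + r * m powr (r - 1) * (h x y / k x - m))
          = k x * m powr r + r * m powr (r - 1) * (h x y - m * k x)"
        using kx by (simp add: distrib_left right_diff_distrib)
      finally show ?thesis .
    qed
    then have "(\<integral>x. k x * m powr r + r * m powr (r - 1) * (h x y - m * k x) \<partial>M1) \<le> (\<integral>x. F x y \<partial>M1)"
      using K(3) G(3)[OF y] IF by (intro integral_mono) auto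
    moreover have "(\<integral>x. k x * m powr r + r * m powr (r - 1) * (h x y - m * k x) \<partial>M1)
      = K * m powr r + r * m powr (r - 1) * (G y - m * K)"
      using K(3) G(3)[OF y] by (simp add: K_def G_def)
    moreover have "G y - m * K = 0"
      using K lo by (simp add: m_def)
    ultimately show ?thesis by (simp add: m_def)
  qed
  have "K powr (1 - r) * (\<integral>y. G y powr r \<partial>M2) = (\<integral>y. K * (G y / K) powr r \<partial>M2)"
  proof -
    have "K * (G y / K) powr r = K powr (1 - r) * G y powr r" if "y \<in> space M2" for y
      using K G[OF that] lo by (simp add: powr_divide powr_diff)
    then show ?thesis by (simp cong: Bochner_Integration.integral_cong)
  qed
  also have "\<dots> \<le> (\<integral>y. (\<integral>x. F x y \<partial>M1) \<partial>M2)"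
  proof (rule integral_mono)
    have "0 \<le> K * (G y / K) powr r \<and> K * (G y / K) powr r \<le> hi * (hi / lo) powr r" if "y \<in> space M2" for y
      using K G[OF that] lo(1) hi0 r by (auto intro!: mult_mono powr_mono2 frac_le)
    then show "integrable M2 (\<lambda>y. K * (G y / K) powr r)"
      by (intro M2.integral_between(3)[where a = 0 and b = "hi * (hi / lo) powr r"]) auto
    show "integrable M2 (\<lambda>y. \<integral>x. F x y \<partial>M1)"
    proof (rule M2.integral_between(3))
      show "0 \<le> (\<integral>x. F x y \<partial>M1)" "(\<integral>x. F x y \<partial>M1) \<le> lo powr (1 - r) * hi powr r" if "y \<in> space M2" for y
        using M1.integral_between[of "\<lambda>x. F x y" 0 "lo powr (1 - r) * hi powr r"] F that hm1[OF that]
        by (auto simp: F_def)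
    qed measurable
  qed (use pt in auto)
  also have "\<dots> = (\<integral>x. (\<integral>y. F x y \<partial>M2) \<partial>M1)"
  proof (rule Fubini_integral)
    show "integrable (M1 \<Otimes>\<^sub>M M2) (\<lambda>(x, y). F x y)"
      by (rule P.integral_between(3)[where a = 0 and b = "lo powr (1 - r) * hi powr r"])
         (use F in \<open>auto simp: space_pair_measure\<close>)
  qed
  also have "\<dots> = (\<integral>x. k x \<partial>M1)"
  proof (rule Bochner_Integration.integral_cong)
    fix x assume x: "x \<in> space M1"
    have "(\<integral>y. F x y \<partial>M2) = k x powr (1 - r) * k x powr r"
      using kr[OF x] by (simp add: F_def)
    also have "\<dots> = k x" using k[OF x] lo by (simp flip: powr_add)
    finally show "(\<integral>y. F x y \<partial>M2) = k x" .
  qed simp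
  finally have "K powr (1 - r) * (\<integral>y. G y powr r \<partial>M2) \<le> K" by (simp add: K_def)
  then have "K powr (r - 1) * (K powr (1 - r) * (\<integral>y. G y powr r \<partial>M2)) \<le> K powr (r - 1) * K"
    by (intro mult_left_mono) auto
  moreover have "K powr (r - 1) * (K powr (1 - r) * z) = z" for z
    using K lo by (simp flip: powr_add mult.assoc)
  moreover have "K powr (r - 1) * K = K powr r"
    using K lo by (simp add: powr_diff)
  ultimately show ?thesis unfolding K_def k_def G_def by simp
qed

section \<open>Laws of extrema as iterated pairs\<close>

text \<open>
Two-sided truncations are the functions that arise from an iterated maximum and minimum when all
variables except one are fixed.
\<close>

definition clamp_real :: "real \<Rightarrow> real \<Rightarrow> real \<Rightarrow> real" where
  "clamp_real a b x = max a (min b x)"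

lemma measurable_clamp_real [measurable]: "clamp_real a b \<in> borel_measurable borel"
  unfolding clamp_real_def by measurable

lemma clamp_real_bounds: "a \<le> b \<Longrightarrow> a \<le> clamp_real a b x" "a \<le> b \<Longrightarrow> clamp_real a b x \<le> b"
  by (auto simp: clamp_real_def)

lemma clamp_real_same [simp]: "clamp_real a a x = a"
  by (simp add: clamp_real_def)

lemma clamp_real_below: "x \<le> a \<Longrightarrow> clamp_real a b x = a"
  by (simp add: clamp_real_def min.coboundedI2 max_absorb1)

definition pair_law :: "(real \<Rightarrow> real \<Rightarrow> real) \<Rightarrow> real measure \<Rightarrow> real measure \<Rightarrow> real measure" where
  "pair_law g \<mu> \<nu> = distr (\<mu> \<Otimes>\<^sub>M \<nu>) borel (\<lambda>(x, y). g x y)"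

lemma max_min_measurable:
  "g \<in> {max, min} \<Longrightarrow> (\<lambda>(x, y). g x y :: real) \<in> borel_measurable (borel \<Otimes>\<^sub>M borel)"
  by auto

text \<open>
A function of \<open>n + 1\<close> independent copies that is computed from the last copy and from the same
function of the first \<open>n\<close> copies has the law of a function of two independent variables. The
congruence assumption says that \<open>F n\<close> looks at the first \<open>n\<close> coordinates only.
\<close>

lemma distr_PiM_Suc:
  assumes "real_distribution \<mu>"
    and g: "(\<lambda>(x, y). g x y) \<in> borel_measurable (borel \<Otimes>\<^sub>M borel)"
    and F: "F n \<in> borel_measurable (\<Pi>\<^sub>M i\<in>{..<n}. borel)"
    and rec: "\<And>x. F (Suc n) x = g (x n) (F n x)"
    and cong: "\<And>x y. (\<And>i. i < n \<Longrightarrow> x i = y i) \<Longrightarrow> F n x = F n y"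
  shows "distr (\<Pi>\<^sub>M i\<in>{..<Suc n}. \<mu>) borel (F (Suc n)) = pair_law g \<mu> (distr (\<Pi>\<^sub>M i\<in>{..<n}. \<mu>) borel (F n))"
proof -
  interpret \<mu>: real_distribution \<mu> by fact
  note [measurable] = g
  define P where "P = (\<Pi>\<^sub>M i\<in>{..<n}. \<mu>)"
  interpret P: prob_space P unfolding P_def by (rule prob_space_PiM) unfold_locales
  have sP: "sets P = sets (\<Pi>\<^sub>M i\<in>{..<n}. borel)" unfolding P_def by (rule sets_PiM_cong) auto
  have Fm [measurable]: "F n \<in> borel_measurable P"
    using F sP measurable_cong_sets by blast
  have ins: "{..<Suc n} = insert n {..<n}" by auto
  have *: "(\<Pi>\<^sub>M i\<in>{..<Suc n}. \<mu>) = distr (\<mu> \<Otimes>\<^sub>M P) (\<Pi>\<^sub>M i\<in>{..<Suc n}. \<mu>) (\<lambda>(x, X). X(n := x))"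
    using distr_pair_PiM_eq_PiM[of "{..<n}" "\<lambda>_. \<mu>" n] \<mu>.prob_space_axioms
    unfolding ins P_def by simp
  have up: "(\<lambda>(x, X). X(n := x)) \<in> measurable (\<mu> \<Otimes>\<^sub>M P) (\<Pi>\<^sub>M i\<in>{..<Suc n}. \<mu>)"
    unfolding ins P_def by measurable
  have FS: "F (Suc n) \<in> borel_measurable (\<Pi>\<^sub>M i\<in>{..<Suc n}. \<mu>)"
  proof -
    have "(\<lambda>x. g (x n) (F n x)) = (\<lambda>x. g (x n) (F n (restrict x {..<n})))"
      by (intro ext arg_cong2[where f = g] cong) auto
    moreover have "(\<lambda>x. restrict x {..<n}) \<in> measurable (\<Pi>\<^sub>M i\<in>{..<Suc n}. \<mu>) P"
      unfolding P_def by (rule measurable_restrict_subset) auto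
    then have "(\<lambda>x. g (x n) (F n (restrict x {..<n}))) \<in> borel_measurable (\<Pi>\<^sub>M i\<in>{..<Suc n}. \<mu>)"
      by measurable
    ultimately show ?thesis using rec by presburger
  qed
  have "distr (\<Pi>\<^sub>M i\<in>{..<Suc n}. \<mu>) borel (F (Suc n))
      = distr (\<mu> \<Otimes>\<^sub>M P) borel (F (Suc n) \<circ> (\<lambda>(x, X). X(n := x)))"
    by (subst *, subst distr_distr[OF FS up]) simp
  also have "F (Suc n) \<circ> (\<lambda>(x, X). X(n := x)) = (\<lambda>(x, X). g x (F n X))"
  proof -
    have "F n (X(n := x)) = F n X" for x X by (rule cong) auto
    then show ?thesis by (auto simp: rec fun_eq_iff)
  qed
  also have "distr (\<mu> \<Otimes>\<^sub>M P) borel (\<lambda>(x, X). g x (F n X))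
      = distr (distr (\<mu> \<Otimes>\<^sub>M P) (borel \<Otimes>\<^sub>M borel) (\<lambda>(x, X). (x, F n X))) borel (\<lambda>(x, y). g x y)"
    by (subst distr_distr) (auto simp: comp_def case_prod_beta intro!: arg_cong2[where f = "distr _"])
  also have "distr (\<mu> \<Otimes>\<^sub>M P) (borel \<Otimes>\<^sub>M borel) (\<lambda>(x, X). (x, F n X)) = distr \<mu> borel (\<lambda>x. x) \<Otimes>\<^sub>M distr P borel (F n)"
    by (rule pair_measure_distr[symmetric])
       (auto intro!: prob_space_imp_sigma_finite P.prob_space_distr)
  also have "distr \<mu> borel (\<lambda>x. x) = \<mu>"
    by (rule distr_id2) simp
  finally show ?thesis unfolding pair_law_def P_def .
qed

lemma extremum_law_one:
  assumes "real_distribution \<mu>"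
  shows "max_law (Suc 0) \<mu> = \<mu>" "min_law (Suc 0) \<mu> = \<mu>"
proof -
  interpret \<mu>: real_distribution \<mu> by fact
  have "distr (\<Pi>\<^sub>M i\<in>{..<Suc 0}. \<mu>) borel (\<lambda>x. x 0) = distr (\<Pi>\<^sub>M i\<in>{..<Suc 0}. \<mu>) \<mu> (\<lambda>x. x 0)"
    by (rule distr_cong) auto
  also have "\<dots> = \<mu>"
    by (rule distr_PiM_component) (auto intro: \<mu>.prob_space_axioms)
  finally have "distr (\<Pi>\<^sub>M i\<in>{..<Suc 0}. \<mu>) borel (\<lambda>x. x 0) = \<mu>" .
  moreover have "{..<Suc 0} = {0}" by auto
  ultimately show "max_law (Suc 0) \<mu> = \<mu>" "min_law (Suc 0) \<mu> = \<mu>"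
    by (simp_all add: max_law_def min_law_def)
qed

lemma extremum_law_Suc:
  assumes "real_distribution \<mu>" "1 \<le> n"
  shows "max_law (Suc n) \<mu> = pair_law max \<mu> (max_law n \<mu>)"
    and "min_law (Suc n) \<mu> = pair_law min \<mu> (min_law n \<mu>)"
proof -
  have ne: "(\<lambda>i. x i) ` {..<n} \<noteq> {}" for x :: "nat \<Rightarrow> real" using assms(2) by (auto simp: lessThan_empty_iff)
  have ins: "(\<lambda>i. x i) ` {..<Suc n} = insert (x n) ((\<lambda>i. x i) ` {..<n})" for x :: "nat \<Rightarrow> real"
    by (auto simp: lessThan_Suc)
  have cong: "(\<lambda>i. x i) ` {..<n} = (\<lambda>i. y i) ` {..<n}" if "\<And>i. i < n \<Longrightarrow> x i = y i" for x y :: "nat \<Rightarrow> real"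
    using that by (auto intro!: image_cong)
  show "max_law (Suc n) \<mu> = pair_law max \<mu> (max_law n \<mu>)"
    unfolding max_law_def
  proof (rule distr_PiM_Suc[where F = "\<lambda>n x. MAX i\<in>{..<n}. x i"])
    show "(\<lambda>x. MAX i\<in>{..<n}. x i :: real) \<in> borel_measurable (\<Pi>\<^sub>M i\<in>{..<n}. borel)"
      by (rule borel_measurable_Max) auto
    show "(MAX i\<in>{..<Suc n}. x i) = max (x n) (MAX i\<in>{..<n}. x i)" for x :: "nat \<Rightarrow> real"
      using ne unfolding ins by (subst Max_insert) auto
    show "(MAX i\<in>{..<n}. x i) = (MAX i\<in>{..<n}. y i)" if "\<And>i. i < n \<Longrightarrow> x i = y i" for x y :: "nat \<Rightarrow> real"
      using cong[of x y] that by simp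
  qed (use assms in auto)
  show "min_law (Suc n) \<mu> = pair_law min \<mu> (min_law n \<mu>)"
    unfolding min_law_def
  proof (rule distr_PiM_Suc[where F = "\<lambda>n x. MIN i\<in>{..<n}. x i"])
    show "(\<lambda>x. MIN i\<in>{..<n}. x i :: real) \<in> borel_measurable (\<Pi>\<^sub>M i\<in>{..<n}. borel)"
      by (rule borel_measurable_Min) auto
    show "(MIN i\<in>{..<Suc n}. x i) = min (x n) (MIN i\<in>{..<n}. x i)" for x :: "nat \<Rightarrow> real"
      using ne unfolding ins by (subst Min_insert) auto
    show "(MIN i\<in>{..<n}. x i) = (MIN i\<in>{..<n}. y i)" if "\<And>i. i < n \<Longrightarrow> x i = y i" for x y :: "nat \<Rightarrow> real"
      using cong[of x y] that by simp
  qed (use assms in auto)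
qed

lemma real_distribution_pair_law:
  assumes "real_distribution \<mu>" "real_distribution \<nu>" "g \<in> {max, min}"
  shows "real_distribution (pair_law g \<mu> \<nu>)"
proof -
  interpret \<mu>: real_distribution \<mu> by fact
  interpret \<nu>: real_distribution \<nu> by fact
  interpret pair_prob_space \<mu> \<nu> ..
  have "(\<lambda>(x, y). g x y) \<in> borel_measurable (\<mu> \<Otimes>\<^sub>M \<nu>)"
    using assms(3) by auto
  then show ?thesis unfolding pair_law_def by (rule P.real_distribution_distr)
qed

text \<open>
Adding one independent copy at a time: whatever passes from \<open>\<nu>\<close> to the maximum and the minimum of an
independent pair of laws \<open>\<mu>\<close> and \<open>\<nu>\<close> passes from \<open>\<mu>\<close> to the extrema of any number of copies of \<open>\<mu>\<close>.
\<close>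

lemma extremum_law_induct :
  assumes \<mu>: "real_distribution \<mu>" and n: "1 \<le> n"
    and base: "P \<mu>"
    and step: "\<And>g \<nu>. g \<in> {max, min} \<Longrightarrow> real_distribution \<nu> \<Longrightarrow> P \<nu> \<Longrightarrow> P (pair_law g \<mu> \<nu>)"
  shows "real_distribution (max_law n \<mu>) \<and> P (max_law n \<mu>)"
    and "real_distribution (min_law n \<mu>) \<and> P (min_law n \<mu>)"
proof -
  show "real_distribution (max_law n \<mu>) \<and> P (max_law n \<mu>)"
    using n
  proof (induction n rule: dec_induct)
    case base then show ?case using extremum_law_one[OF \<mu>] \<mu> assms(3) by simp
  next
    case (step n) then show ?case
      using extremum_law_Suc[OF \<mu>] real_distribution_pair_law[OF \<mu>] assms(4)[of max] by simp
  qed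
  show "real_distribution (min_law n \<mu>) \<and> P (min_law n \<mu>)"
    using n
  proof (induction n rule: dec_induct)
    case base then show ?case using extremum_law_one[OF \<mu>] \<mu> assms(3) by simp
  next
    case (step n) then show ?case
      using extremum_law_Suc[OF \<mu>] real_distribution_pair_law[OF \<mu>] assms(4)[of min] by simp
  qed
qed

section \<open>Truncation-contractive laws\<close>

text \<open>
For \<open>X\<close> of law \<open>\<nu>\<close> this says \<open>\<parallel>a \<or> (b \<and> s X)\<parallel>\<^sub>q \<le> \<parallel>a \<or> (b \<and> X)\<parallel>\<^sub>p\<close> for all \<open>0 < a \<le> b\<close>, raised to the
power \<open>q\<close>. The strict bound \<open>0 < a\<close> keeps all truncations in a compact part of the positive half-line,
so that integrability is automatic and no quotient degenerates; \<open>a \<rightarrow> 0\<close> and \<open>b \<rightarrow> \<infinity>\<close> recover the norms.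
\<close>

definition truncation_contractive :: "real \<Rightarrow> real \<Rightarrow> real \<Rightarrow> real measure \<Rightarrow> bool" where
  "truncation_contractive p q s \<nu> \<longleftrightarrow> (\<forall>a b. 0 < a \<and> a \<le> b \<longrightarrow>
     (\<integral>x. clamp_real a b (s * x) powr q \<partial>\<nu>) \<le> (\<integral>x. clamp_real a b x powr p \<partial>\<nu>) powr (q / p))"

text \<open>
The family of truncations is closed under fixing one variable: a truncation of \<open>max x y\<close> only raises
the lower level, a truncation of \<open>min x y\<close> only lowers the upper one. This is what makes truncations
the right test functions for an induction over maxima and minima.
\<close>

lemma clamp_real_section:
  assumes "g \<in> {max, min}" "a \<le> b"
  shows "\<exists>a' b'. a \<le> a' \<and> a' \<le> b' \<and> (\<forall>x. clamp_real a b (g x y) = clamp_real a' b' x)"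
proof (cases "g = max")
  case True
  then show ?thesis using assms
    by (intro exI[of _ "clamp_real a b y"] exI[of _ b]) (auto simp: clamp_real_def max_def min_def)
next
  case False
  then show ?thesis using assms
    by (intro exI[of _ a] exI[of _ "clamp_real a b y"]) (auto simp: clamp_real_def max_def min_def)
qed

lemma integral_pair_law:
  fixes f :: "real \<Rightarrow> real"
  assumes "real_distribution \<mu>" "real_distribution \<nu>" and g: "g \<in> {max, min}"
    and [measurable]: "f \<in> borel_measurable borel"
    and bound: "\<And>x. 0 \<le> f x" "\<And>x. f x \<le> c"
  shows "(\<integral>z. f z \<partial>pair_law g \<mu> \<nu>) = (\<integral>x. (\<integral>y. f (g x y) \<partial>\<nu>) \<partial>\<mu>)"
    and "(\<integral>z. f z \<partial>pair_law g \<mu> \<nu>) = (\<integral>y. (\<integral>x. f (g x y) \<partial>\<mu>) \<partial>\<nu>)"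
proof -
  interpret \<mu>: real_distribution \<mu> by fact
  interpret \<nu>: real_distribution \<nu> by fact
  interpret pair_prob_space \<mu> \<nu> ..
  have [measurable]: "(\<lambda>(x, y). g x y) \<in> borel_measurable (borel \<Otimes>\<^sub>M borel)"
    using g by (rule max_min_measurable)
  have I: "integrable (\<mu> \<Otimes>\<^sub>M \<nu>) (\<lambda>(x, y). f (g x y))"
    by (rule P.integral_between(3)[where a = 0 and b = c]) (use bound in auto)
  have "(\<integral>z. f z \<partial>pair_law g \<mu> \<nu>) = (\<integral>z. (case z of (x, y) \<Rightarrow> f (g x y)) \<partial>(\<mu> \<Otimes>\<^sub>M \<nu>))"
    unfolding pair_law_def by (subst integral_distr) (auto simp: case_prod_unfold)
  then show "(\<integral>z. f z \<partial>pair_law g \<mu> \<nu>) = (\<integral>x. (\<integral>y. f (g x y) \<partial>\<nu>) \<partial>\<mu>)"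
    and "(\<integral>z. f z \<partial>pair_law g \<mu> \<nu>) = (\<integral>y. (\<integral>x. f (g x y) \<partial>\<mu>) \<partial>\<nu>)"
    using integral_fst[OF I] integral_snd[OF I] by simp_all
qed

text \<open>
The tensorization step. For fixed \<open>y\<close> the truncated function of \<open>x\<close> is again a truncation, so the
hypothesis on \<open>\<mu>\<close> replaces the norm of exponent \<open>q\<close> in \<open>x\<close> by one of exponent \<open>p\<close> and removes the factor
\<open>s\<close> from \<open>x\<close>. Since \<open>p \<le> q\<close>, Minkowski's inequality allows the two norms to be taken in the opposite
order, and the hypothesis on \<open>\<nu>\<close> then treats \<open>y\<close> in the same way. The constant \<open>s\<close> does not deteriorate,
which is why it survives any number of iterations.
\<close>

lemma truncation_contractive_pair_law:
  assumes "real_distribution \<mu>" "real_distribution \<nu>" and g: "g \<in> {max, min}"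
    and pq: "0 < p" "p \<le> q" and s: "0 < s"
    and \<mu>: "truncation_contractive p q s \<mu>" and \<nu>: "truncation_contractive p q s \<nu>"
  shows "truncation_contractive p q s (pair_law g \<mu> \<nu>)"
  unfolding truncation_contractive_def
proof (intro allI impI)
  fix a b :: real assume ab: "0 < a \<and> a \<le> b"
  interpret \<mu>: real_distribution \<mu> by fact
  interpret \<nu>: real_distribution \<nu> by fact
  interpret pair_prob_space \<mu> \<nu> ..
  define r where "r = q / p"
  have r: "1 \<le> r" "p * r = q" using pq by (auto simp: r_def)
  define f where "f = clamp_real a b"
  have f: "a \<le> f x" "f x \<le> b" for x using ab by (auto simp: f_def clamp_real_bounds)
  have [measurable]: "f \<in> borel_measurable borel" by (simp add: f_def)
  have [measurable]: "(\<lambda>(x, y). g x y) \<in> borel_measurable (borel \<Otimes>\<^sub>M borel)"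
    using g by (rule max_min_measurable)
  have ft: "a powr t \<le> f x powr t" "f x powr t \<le> b powr t" "0 \<le> f x powr t" if "0 < t" for x t
    using f[of x] ab that by (auto intro!: powr_mono2)
  have q: "0 < q" using pq by simp
  have gs: "s * g x y = g (s * x) (s * y)" for x y
    using g s by (auto simp: max_mult_distrib_left min_mult_distrib_left)
  have comm: "g x y = g y x" for x y using g by (auto simp: max.commute min.commute)
  have sx: "(\<integral>x. f (g (s * x) y) powr q \<partial>\<mu>) \<le> (\<integral>x. f (g x y) powr p \<partial>\<mu>) powr r" for y
  proof -
    obtain a' b' where *: "a \<le> a'" "a' \<le> b'" "\<And>x. f (g x y) = clamp_real a' b' x"
      unfolding f_def using clamp_real_section[OF g, of a b y] ab by auto
    with \<mu> ab show ?thesis unfolding truncation_contractive_def r_def by simp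
  qed
  have sy: "(\<integral>y. f (g x (s * y)) powr q \<partial>\<nu>) \<le> (\<integral>y. f (g x y) powr p \<partial>\<nu>) powr r" for x
  proof -
    obtain a' b' where *: "a \<le> a'" "a' \<le> b'" "\<And>y. f (g y x) = clamp_real a' b' y"
      unfolding f_def using clamp_real_section[OF g, of a b x] ab by auto
    with \<nu> ab show ?thesis unfolding truncation_contractive_def r_def by (simp add: comm[of x])
  qed
  have bx: "a powr t \<le> (\<integral>x. f (g (h x) y) powr t \<partial>\<mu>)" "(\<integral>x. f (g (h x) y) powr t \<partial>\<mu>) \<le> b powr t"
    if "0 < t" and [measurable]: "h \<in> borel_measurable borel" for y t h
    using \<mu>.integral_between(1,2)[of "\<lambda>x. f (g (h x) y) powr t" "a powr t" "b powr t"] ft[OF that(1)] by auto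
  have byy: "a powr t \<le> (\<integral>y. f (g x (h y)) powr t \<partial>\<nu>)" "(\<integral>y. f (g x (h y)) powr t \<partial>\<nu>) \<le> b powr t"
    if "0 < t" and [measurable]: "h \<in> borel_measurable borel" for x t h
    using \<nu>.integral_between(1,2)[of "\<lambda>y. f (g x (h y)) powr t" "a powr t" "b powr t"] ft[OF that(1)] by auto
  have "(\<integral>z. f (s * z) powr q \<partial>pair_law g \<mu> \<nu>) = (\<integral>y. (\<integral>x. f (s * g x y) powr q \<partial>\<mu>) \<partial>\<nu>)"
    by (rule integral_pair_law(2)[OF assms(1,2) g, where c = "b powr q"]) (use ft q in auto)
  also have "\<dots> = (\<integral>y. (\<integral>x. f (g (s * x) (s * y)) powr q \<partial>\<mu>) \<partial>\<nu>)" by (simp only: gs)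
  also have "\<dots> \<le> (\<integral>y. (\<integral>x. f (g x (s * y)) powr p \<partial>\<mu>) powr r \<partial>\<nu>)"
  proof (rule integral_mono)
    show "integrable \<nu> (\<lambda>y. \<integral>x. f (g (s * x) (s * y)) powr q \<partial>\<mu>)"
      by (rule \<nu>.integral_between(3)[of _ "a powr q" "b powr q"]) (use bx[of q] q in auto)
    show "integrable \<nu> (\<lambda>y. (\<integral>x. f (g x (s * y)) powr p \<partial>\<mu>) powr r)"
      by (rule \<nu>.integral_between(3)[of _ 0 "(b powr p) powr r"])
         (use bx[of p "\<lambda>x. x"] pq r in \<open>auto intro!: powr_mono2 integral_nonneg\<close>)
  qed (rule sx)
  \<comment> \<open>exchange of the two norms\<close>
  also have "\<dots> \<le> (\<integral>x. (\<integral>y. (f (g x (s * y)) powr p) powr r \<partial>\<nu>) powr (1/r) \<partial>\<mu>) powr r"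
    by (rule Minkowski_integral_inequality[where lo = "a powr p" and hi = "b powr p"])
       (use ft[OF pq(1)] ab r in \<open>auto intro: \<mu>.prob_space_axioms \<nu>.prob_space_axioms\<close>)
  also have "\<dots> = (\<integral>x. (\<integral>y. f (g x (s * y)) powr q \<partial>\<nu>) powr (1/r) \<partial>\<mu>) powr r"
    by (simp add: powr_powr r)
  also have "\<dots> \<le> (\<integral>x. (\<integral>y. f (g x y) powr p \<partial>\<nu>) \<partial>\<mu>) powr r"
  proof (rule powr_mono2)
    show "(\<integral>x. (\<integral>y. f (g x (s * y)) powr q \<partial>\<nu>) powr (1/r) \<partial>\<mu>) \<le> (\<integral>x. (\<integral>y. f (g x y) powr p \<partial>\<nu>) \<partial>\<mu>)"
    proof (rule integral_mono)
      show "integrable \<mu> (\<lambda>x. (\<integral>y. f (g x (s * y)) powr q \<partial>\<nu>) powr (1/r))"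
        by (rule \<mu>.integral_between(3)[of _ 0 "(b powr q) powr (1/r)"])
           (use byy[of q] q r in \<open>auto intro!: powr_mono2 integral_nonneg\<close>)
      show "integrable \<mu> (\<lambda>x. \<integral>y. f (g x y) powr p \<partial>\<nu>)"
        by (rule \<mu>.integral_between(3)[of _ "a powr p" "b powr p"]) (use byy[of p "\<lambda>y. y"] pq in auto)
      show "(\<integral>y. f (g x (s * y)) powr q \<partial>\<nu>) powr (1/r) \<le> (\<integral>y. f (g x y) powr p \<partial>\<nu>)" for x
      proof -
        have "(\<integral>y. f (g x (s * y)) powr q \<partial>\<nu>) powr (1/r) \<le> ((\<integral>y. f (g x y) powr p \<partial>\<nu>) powr r) powr (1/r)"
          using sy[of x] r by (intro powr_mono2) (auto intro!: integral_nonneg)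
        also have "\<dots> = (\<integral>y. f (g x y) powr p \<partial>\<nu>)"
          using r by (simp add: powr_powr integral_nonneg)
        finally show ?thesis .
      qed
    qed
  qed (use r in \<open>auto intro!: integral_nonneg\<close>)
  also have "(\<integral>x. (\<integral>y. f (g x y) powr p \<partial>\<nu>) \<partial>\<mu>) = (\<integral>z. f z powr p \<partial>pair_law g \<mu> \<nu>)"
    by (rule integral_pair_law(1)[OF assms(1,2) g, where c = "b powr p", symmetric]) (use ft pq in auto)
  finally show "(\<integral>x. clamp_real a b (s * x) powr q \<partial>pair_law g \<mu> \<nu>)
      \<le> (\<integral>x. clamp_real a b x powr p \<partial>pair_law g \<mu> \<nu>) powr (q / p)"
    by (simp add: f_def r_def)
qed

text \<open>
Truncation levels \<open>1 / (n + 1)\<close> and \<open>n + 1\<close>: dominated convergence applies because a truncation at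
levels below and above \<open>1\<close> is at most \<open>max 1 \<bar>z\<bar>\<close>.
\<close>

lemma truncated_moments_tendsto:
  assumes "real_distribution \<nu>" and nn: "AE x in \<nu>. 0 \<le> x" and I: "integrable \<nu> (\<lambda>x. \<bar>x\<bar> powr t)"
    and t: "0 < t" and s: "0 < s"
  shows "(\<lambda>n. \<integral>x. clamp_real (1 / real (Suc n)) (real (Suc n)) (s * x) powr t \<partial>\<nu>)
    \<longlonglongrightarrow> s powr t * (\<integral>x. \<bar>x\<bar> powr t \<partial>\<nu>)"
proof -
  interpret \<nu>: real_distribution \<nu> by fact
  have *: "s powr t * (\<integral>x. \<bar>x\<bar> powr t \<partial>\<nu>) = (\<integral>x. \<bar>s * x\<bar> powr t \<partial>\<nu>)"
    using s by (simp add: abs_mult powr_mult)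
  have I2: "integrable \<nu> (\<lambda>x. 1 + \<bar>s * x\<bar> powr t)"
    using I s by (simp add: abs_mult powr_mult)
  show ?thesis unfolding *
  proof (rule integral_dominated_convergence[where w = "\<lambda>x. 1 + \<bar>s * x\<bar> powr t"])
    show "AE x in \<nu>. (\<lambda>n. clamp_real (1 / real (Suc n)) (real (Suc n)) (s * x) powr t) \<longlonglongrightarrow> \<bar>s * x\<bar> powr t"
      using nn
    proof eventually_elim
      fix x :: real assume "0 \<le> x"
      then have z: "0 \<le> s * x" using s by simp
      define z where "z = s * x"
      have "eventually (\<lambda>n. z \<le> real n) sequentially"
        using eventually_ge_at_top[of "nat \<lceil>z\<rceil>"] by eventually_elim linarith
      then have "eventually (\<lambda>n. max (1 / real (Suc n)) z = clamp_real (1 / real (Suc n)) (real (Suc n)) z) sequentially"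
        by eventually_elim (auto simp: clamp_real_def)
      moreover have "(\<lambda>n. max (1 / real (Suc n)) z) \<longlonglongrightarrow> max 0 z"
        by (intro tendsto_intros LIMSEQ_Suc[OF lim_1_over_n])
      ultimately have "(\<lambda>n. clamp_real (1 / real (Suc n)) (real (Suc n)) z) \<longlonglongrightarrow> max 0 z"
        by (rule Lim_transform_eventually[rotated])
      then have "(\<lambda>n. clamp_real (1 / real (Suc n)) (real (Suc n)) z powr t) \<longlonglongrightarrow> max 0 z powr t"
        using t by (intro tendsto_powr') (auto intro!: always_eventually simp: clamp_real_def le_max_iff_disj)
      then show "(\<lambda>n. clamp_real (1 / real (Suc n)) (real (Suc n)) (s * x) powr t) \<longlonglongrightarrow> \<bar>s * x\<bar> powr t"
        using z by (simp add: z_def max_def split: if_splits)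
    qed
    show "AE x in \<nu>. norm (clamp_real (1 / real (Suc n)) (real (Suc n)) (s * x) powr t) \<le> 1 + \<bar>s * x\<bar> powr t" for n
    proof (rule AE_I2)
      fix x
      have pos: "0 \<le> 1 / real (Suc n)" "1 / real (Suc n) \<le> 1" by (auto simp: field_simps)
      have "0 \<le> clamp_real (1 / real (Suc n)) (real (Suc n)) (s * x)"
        "clamp_real (1 / real (Suc n)) (real (Suc n)) (s * x) \<le> max 1 \<bar>s * x\<bar>"
        using pos unfolding clamp_real_def by linarith+
      then have "clamp_real (1 / real (Suc n)) (real (Suc n)) (s * x) powr t \<le> max 1 \<bar>s * x\<bar> powr t"
        using t by (intro powr_mono2) auto
      also have "\<dots> \<le> 1 + \<bar>s * x\<bar> powr t" by (simp add: max_def)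
      finally show "norm (clamp_real (1 / real (Suc n)) (real (Suc n)) (s * x) powr t) \<le> 1 + \<bar>s * x\<bar> powr t"
        by simp
    qed
  qed (use I2 in auto)
qed

text \<open>
The standing assumptions on the laws in question, gathered because they are inherited together by
maxima and minima.
\<close>

definition moment_law :: "real \<Rightarrow> real measure \<Rightarrow> bool" where
  "moment_law q \<mu> \<longleftrightarrow> real_distribution \<mu> \<and> (AE x in \<mu>. 0 \<le> x) \<and> integrable \<mu> (\<lambda>x. \<bar>x\<bar> powr q)"

lemma moment_law_mono:
  assumes "moment_law q \<mu>" "0 < p" "p \<le> q"
  shows "moment_law p \<mu>"
proof -
  interpret real_distribution \<mu> using assms by (simp add: moment_law_def)
  have le: "\<bar>x\<bar> powr p \<le> 1 + \<bar>x\<bar> powr q" for x :: real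
  proof (cases "\<bar>x\<bar> \<le> 1")
    case True then show ?thesis using assms powr_le1[of p "\<bar>x\<bar>"] by (simp add: add_increasing2)
  next
    case False then show ?thesis using assms powr_mono[of p q "\<bar>x\<bar>"] by linarith
  qed
  have "integrable \<mu> (\<lambda>x. \<bar>x\<bar> powr p)"
    by (rule Bochner_Integration.integrable_bound[of \<mu> "\<lambda>x. 1 + \<bar>x\<bar> powr q"])
      (use assms le in \<open>auto simp: moment_law_def\<close>)
  then show ?thesis using assms by (simp add: moment_law_def)
qed

lemma moment_law_pair_law:
  assumes \<mu>: "moment_law q \<mu>" and \<nu>: "moment_law q \<nu>" and g: "g \<in> {max, min}"
  shows "moment_law q (pair_law g \<mu> \<nu>)"
proof -
  interpret \<mu>: real_distribution \<mu> using \<mu> by (simp add: moment_law_def)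
  interpret \<nu>: real_distribution \<nu> using \<nu> by (simp add: moment_law_def)
  interpret pair_prob_space \<mu> \<nu> ..
  have gm [measurable]: "(\<lambda>(x, y). g x y) \<in> borel_measurable (borel \<Otimes>\<^sub>M borel)"
    using g by (rule max_min_measurable)
  have fst: "distr (\<mu> \<Otimes>\<^sub>M \<nu>) \<mu> fst = \<mu>"
    by (rule \<nu>.distr_pair_fst)
  have snd: "distr (\<mu> \<Otimes>\<^sub>M \<nu>) \<nu> snd = \<nu>"
    by (subst distr_pair_swap) (simp add: distr_distr comp_def case_prod_beta \<mu>.distr_pair_fst)
  have I1: "integrable (\<mu> \<Otimes>\<^sub>M \<nu>) (\<lambda>z. \<bar>fst z\<bar> powr q)"
    using \<mu> integrable_distr[of fst "\<mu> \<Otimes>\<^sub>M \<nu>" \<mu> "\<lambda>x. \<bar>x\<bar> powr q"] by (simp add: fst moment_law_def)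
  have I2: "integrable (\<mu> \<Otimes>\<^sub>M \<nu>) (\<lambda>z. \<bar>snd z\<bar> powr q)"
    using \<nu> integrable_distr[of snd "\<mu> \<Otimes>\<^sub>M \<nu>" \<nu> "\<lambda>x. \<bar>x\<bar> powr q"] by (simp add: snd moment_law_def)
  have "integrable (\<mu> \<Otimes>\<^sub>M \<nu>) (\<lambda>(x, y). \<bar>g x y\<bar> powr q)"
    by (rule Bochner_Integration.integrable_bound[OF Bochner_Integration.integrable_add[OF I1 I2]])
       (use g in \<open>auto simp: max_def min_def\<close>)
  then have "integrable (pair_law g \<mu> \<nu>) (\<lambda>x. \<bar>x\<bar> powr q)"
    unfolding pair_law_def by (subst integrable_distr_eq) (auto simp: case_prod_unfold)
  moreover have "AE z in \<mu> \<Otimes>\<^sub>M \<nu>. 0 \<le> g (fst z) (snd z)"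
  proof -
    have "AE z in \<mu> \<Otimes>\<^sub>M \<nu>. 0 \<le> fst z"
      by (rule AE_distrD[OF measurable_fst]) (use \<mu> in \<open>unfold fst moment_law_def, blast\<close>)
    moreover have "AE z in \<mu> \<Otimes>\<^sub>M \<nu>. 0 \<le> snd z"
      by (rule AE_distrD[OF measurable_snd]) (use \<nu> in \<open>unfold snd moment_law_def, blast\<close>)
    ultimately show ?thesis by eventually_elim (use g in auto)
  qed
  then have "AE x in pair_law g \<mu> \<nu>. 0 \<le> x"
    unfolding pair_law_def by (subst AE_distr_iff) (auto simp: case_prod_beta)
  moreover have "real_distribution (pair_law g \<mu> \<nu>)"
    by (rule real_distribution_pair_law) (use g in \<open>auto intro: \<mu>.real_distribution_axioms \<nu>.real_distribution_axioms\<close>)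
  ultimately show ?thesis by (simp add: moment_law_def)
qed

lemma moment_law_extremum:
  assumes "moment_law q \<mu>" "1 \<le> n"
  shows "moment_law q (max_law n \<mu>)" "moment_law q (min_law n \<mu>)"
proof -
  have \<mu>: "real_distribution \<mu>" using assms by (simp add: moment_law_def)
  show "moment_law q (max_law n \<mu>)" "moment_law q (min_law n \<mu>)"
    using extremum_law_induct[OF \<mu> assms(2), where P = "moment_law q"] assms moment_law_pair_law
    by blast+
qed

lemma truncation_contractive_extremum:
  assumes "real_distribution \<mu>" "1 \<le> n" "0 < p" "p \<le> q" "0 < s" "truncation_contractive p q s \<mu>"
  shows "truncation_contractive p q s (max_law n \<mu>)" "truncation_contractive p q s (min_law n \<mu>)"
  using extremum_law_induct[OF assms(1,2), where P = "truncation_contractive p q s"] assms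
    truncation_contractive_pair_law[of \<mu>]
  by blast+

lemma maxmin_law_preserves:
  assumes "moment_law q \<mu>" "0 < p" "p \<le> q" "0 < s" "truncation_contractive p q s \<mu>"
    and "\<forall>(n, k) \<in> set nks. 1 \<le> n \<and> 1 \<le> k"
  shows "moment_law q (maxmin_law nks \<mu>) \<and> truncation_contractive p q s (maxmin_law nks \<mu>)"
  using assms(6)
proof (induction nks)
  case Nil
  then show ?case using assms by (simp add: maxmin_law_def)
next
  case (Cons nk nks)
  obtain n k where nk: "nk = (n, k)" by fastforce
  have eq: "maxmin_law (nk # nks) \<mu> = max_law n (min_law k (maxmin_law nks \<mu>))"
    by (simp add: maxmin_law_def nk)
  show ?case unfolding eq
    using Cons nk assms(2,3,4) moment_law_extremum[of q] truncation_contractive_extremum[of _ _ p q s]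
    by (simp add: moment_law_def)
qed

lemma law_norm_le_of_truncation_contractive:
  assumes \<nu>: "moment_law q \<nu>" and "0 < p" "p \<le> q" "0 < s" and c: "truncation_contractive p q s \<nu>"
  shows "s * law_norm q \<nu> \<le> law_norm p \<nu>"
proof -
  have \<nu>p: "moment_law p \<nu>" using moment_law_mono[OF \<nu>] assms by simp
  define Q where "Q = (\<integral>x. \<bar>x\<bar> powr q \<partial>\<nu>)"
  define P where "P = (\<integral>x. \<bar>x\<bar> powr p \<partial>\<nu>)"
  have [simp]: "0 \<le> Q" "0 \<le> P" by (auto simp: Q_def P_def)
  have lq: "(\<lambda>n. \<integral>x. clamp_real (1 / real (Suc n)) (real (Suc n)) (s * x) powr q \<partial>\<nu>) \<longlonglongrightarrow> s powr q * Q"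
    unfolding Q_def by (rule truncated_moments_tendsto) (use assms in \<open>auto simp: moment_law_def\<close>)
  have lp: "(\<lambda>n. \<integral>x. clamp_real (1 / real (Suc n)) (real (Suc n)) x powr p \<partial>\<nu>) \<longlonglongrightarrow> P"
    using truncated_moments_tendsto[of \<nu> p 1] \<nu>p assms unfolding P_def by (simp add: moment_law_def)
  have "s powr q * Q \<le> P powr (q / p)"
  proof (rule LIMSEQ_le[OF lq tendsto_powr'[OF lp tendsto_const[of "q / p"]]])
    show "\<exists>N. \<forall>n\<ge>N. (\<integral>x. clamp_real (1 / real (Suc n)) (real (Suc n)) (s * x) powr q \<partial>\<nu>)
        \<le> (\<integral>x. clamp_real (1 / real (Suc n)) (real (Suc n)) x powr p \<partial>\<nu>) powr (q / p)"
      using c unfolding truncation_contractive_def by (intro exI[of _ 0]) (auto simp: field_simps)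
  qed (use assms in auto)
  then have "(s powr q * Q) powr (1/q) \<le> (P powr (q / p)) powr (1/q)"
    using assms by (intro powr_mono2) auto
  then show ?thesis
    using assms by (simp add: powr_mult powr_powr law_norm_def Q_def P_def)
qed

section \<open>Truncation contractivity from tail estimates\<close>

text \<open>
The tangent line of \<open>z \<mapsto> z powr (q / p)\<close> at \<open>x powr p\<close>, evaluated at \<open>1\<close>. It compares the two powers for
truncations at close levels, where both sides vanish to first order.
\<close>

lemma powr_minus_one_le:
  fixes x :: real
  assumes "0 < p" "p \<le> q" "1 \<le> x" "x \<le> 2"
  shows "x powr q - 1 \<le> q / p * 2 powr (q - p) * (x powr p - 1)"
proof -
  define r where "r = q / p"
  have r: "1 \<le> r" "p * r = q" "p * (r - 1) = q - p" using assms by (auto simp: r_def field_simps)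
  have "(x powr p) powr r + r * (x powr p) powr (r - 1) * (1 - x powr p) \<le> 1 powr r"
    by (rule powr_above_tangent) (use assms r in auto)
  then have "x powr q - 1 \<le> r * x powr (q - p) * (x powr p - 1)"
    by (simp add: powr_powr r algebra_simps)
  also have "\<dots> \<le> r * 2 powr (q - p) * (x powr p - 1)"
    using assms r by (intro mult_right_mono mult_left_mono powr_mono2) (auto intro: ge_one_powr_ge_zero)
  finally show ?thesis by (simp add: r_def)
qed

text \<open>
The excess over the level \<open>u\<close>. On the left it is supported where \<open>s X > u\<close>, a far tail event when \<open>s\<close> is
small; on the right it is bounded below on \<open>X \<ge> 2 u\<close>. The tail hypothesis says that the former is
negligible compared with the latter. Both excesses tend to \<open>0\<close> as \<open>b\<close> decreases to \<open>u\<close>, so for \<open>b \<le> 2 u\<close>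
the factor depending on \<open>b / u\<close> has to be kept; for \<open>b > 2 u\<close> the truncation of \<open>s X\<close> can be dropped and the
truncation of \<open>X\<close> lowered to the level \<open>2 u\<close>. The two upper bounds on \<open>\<kappa>\<close> belong to these two cases.
\<close>

lemma upper_truncation_le:
  assumes "moment_law q \<mu>" and pq: "0 < p" "p < q" and s: "0 < s" and u: "0 < u" "u \<le> b"
    and \<kappa>: "\<kappa> \<le> 2 powr (p - q)" "\<kappa> \<le> q / p * (2 powr p - 1)" "0 \<le> \<kappa>"
    and tail: "(\<integral>x. \<bar>s * x\<bar> powr q * indicator {x. u < s * x} x \<partial>\<mu>) \<le> \<kappa> * u powr q * measure \<mu> {2 * u..}"
  shows "(\<integral>x. (clamp_real u b (s * x) / u) powr q - 1 \<partial>\<mu>) \<le> q / p * (\<integral>x. (clamp_real u b x / u) powr p - 1 \<partial>\<mu>)"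
proof -
  interpret real_distribution \<mu> using assms(1) by (simp add: moment_law_def)
  have I: "integrable \<mu> (\<lambda>x. \<bar>x\<bar> powr q)" using assms(1) by (simp add: moment_law_def)
  define \<phi> where "\<phi> = (\<lambda>x. \<bar>s * x\<bar> powr q * indicator {x. u < s * x} x)"
  have I\<phi>: "integrable \<mu> \<phi>"
    unfolding \<phi>_def using s I by (intro integrable_real_mult_indicator) (auto simp: abs_mult powr_mult)
  define \<pi> where "\<pi> = measure \<mu> {2 * u..}"
  define \<beta> where "\<beta> = b / u"
  have \<beta>: "1 \<le> \<beta>" using u by (simp add: \<beta>_def)
  have eq: "clamp_real u b x / u = clamp_real 1 \<beta> (x / u)" for x
    using u by (auto simp: clamp_real_def \<beta>_def max_def min_def field_simps)
  have cl: "1 \<le> clamp_real 1 \<beta> x" "clamp_real 1 \<beta> x \<le> \<beta>" for x using \<beta> by (auto simp: clamp_real_bounds)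
  have cp: "1 \<le> clamp_real 1 \<beta> x powr t" "clamp_real 1 \<beta> x powr t \<le> \<beta> powr t" if "0 < t" for x t
    using cl[of x] that by (auto intro!: powr_mono2 ge_one_powr_ge_zero)
  have IA: "integrable \<mu> (\<lambda>x. clamp_real 1 \<beta> (s * x / u) powr q - 1)"
    by (rule integral_between(3)[of _ 0 "\<beta> powr q"]) (use cp[of q] pq in \<open>auto simp: diff_le_eq add_increasing2\<close>)
  have IB: "integrable \<mu> (\<lambda>x. clamp_real 1 \<beta> (x / u) powr p - 1)"
    by (rule integral_between(3)[of _ 0 "\<beta> powr p"]) (use cp[of p] pq in \<open>auto simp: diff_le_eq add_increasing2\<close>)
  have lower: "(d powr p - 1) * \<pi> \<le> (\<integral>x. clamp_real 1 \<beta> (x / u) powr p - 1 \<partial>\<mu>)" if d: "1 \<le> d" "d \<le> \<beta>" "d \<le> 2" for d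
  proof -
    have "(d powr p - 1) * \<pi> = (\<integral>x. (d powr p - 1) * indicator {2 * u..} x \<partial>\<mu>)"
      by (simp add: \<pi>_def)
    also have "\<dots> \<le> (\<integral>x. clamp_real 1 \<beta> (x / u) powr p - 1 \<partial>\<mu>)"
    proof (rule integral_mono[OF _ IB])
      fix x
      have "d powr p \<le> clamp_real 1 \<beta> (x / u) powr p" if "2 * u \<le> x"
      proof (rule powr_mono2)
        have "2 \<le> x / u" using that u by (simp add: field_simps)
        then show "d \<le> clamp_real 1 \<beta> (x / u)" using d by (auto simp: clamp_real_def)
      qed (use pq d in auto)
      then show "(d powr p - 1) * indicator {2 * u..} x \<le> clamp_real 1 \<beta> (x / u) powr p - 1"
        using cp(1)[of p "x / u"] pq by (auto simp: indicator_def)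
    qed (rule integrable_mult_indicator_const, simp)
    finally show ?thesis .
  qed
  have I\<phi>': "integral\<^sup>L \<mu> \<phi> / u powr q \<le> \<kappa> * \<pi>"
    using tail u by (simp add: \<phi>_def \<pi>_def field_simps)
  have A: "clamp_real 1 \<beta> (s * x / u) powr q - 1 \<le> \<phi> x / u powr q" for x
  proof (cases "u < s * x")
    case True
    have "clamp_real 1 \<beta> (s * x / u) powr q \<le> (s * x / u) powr q"
      using True u pq \<beta> by (intro powr_mono2) (auto simp: clamp_real_def max_def min_def field_simps)
    then show ?thesis using True u by (simp add: \<phi>_def powr_divide)
  next
    case False
    then have "clamp_real 1 \<beta> (s * x / u) = 1" using u by (intro clamp_real_below) simp
    then show ?thesis using u \<open>\<not> u < s * x\<close> by (simp add: \<phi>_def)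
  qed
  have "(\<integral>x. clamp_real 1 \<beta> (s * x / u) powr q - 1 \<partial>\<mu>) \<le> q / p * (\<integral>x. clamp_real 1 \<beta> (x / u) powr p - 1 \<partial>\<mu>)"
  proof (cases "\<beta> \<le> 2")
    case True
    have B: "clamp_real 1 \<beta> (s * x / u) powr q - 1 \<le> (\<beta> powr q - 1) * (\<phi> x / u powr q)" for x
    proof (cases "u < s * x")
      case True
      then have "u powr q \<le> (s * x) powr q" using u pq by (intro powr_mono2) auto
      then have "1 \<le> \<phi> x / u powr q" using True u by (simp add: \<phi>_def)
      then have "(\<beta> powr q - 1) * 1 \<le> (\<beta> powr q - 1) * (\<phi> x / u powr q)"
        using \<beta> pq by (intro mult_left_mono) (auto intro: ge_one_powr_ge_zero)
      then show ?thesis using cp(2)[of q "s * x / u"] pq by simp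
    next
      case False
      then have "clamp_real 1 \<beta> (s * x / u) = 1" using u by (intro clamp_real_below) simp
    then show ?thesis using u \<open>\<not> u < s * x\<close> by (simp add: \<phi>_def)
    qed
    have "(\<integral>x. clamp_real 1 \<beta> (s * x / u) powr q - 1 \<partial>\<mu>) \<le> (\<integral>x. (\<beta> powr q - 1) * (\<phi> x / u powr q) \<partial>\<mu>)"
      using B by (intro integral_mono IA) (use I\<phi> in auto)
    also have "\<dots> = (\<beta> powr q - 1) * (integral\<^sup>L \<mu> \<phi> / u powr q)" by simp
    also have "\<dots> \<le> (\<beta> powr q - 1) * (2 powr (p - q) * \<pi>)"
      using \<beta> pq I\<phi>' \<kappa> by (intro mult_left_mono order_trans[OF I\<phi>' mult_right_mono])
        (auto simp: \<pi>_def intro: ge_one_powr_ge_zero)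
    also have "\<dots> \<le> (q / p * 2 powr (q - p) * (\<beta> powr p - 1)) * (2 powr (p - q) * \<pi>)"
      using powr_minus_one_le[of p q \<beta>] pq \<beta> True by (intro mult_right_mono) (auto simp: \<pi>_def)
    also have "\<dots> = q / p * ((2 powr (q - p) * 2 powr (p - q)) * ((\<beta> powr p - 1) * \<pi>))" by simp
    also have "2 powr (q - p) * 2 powr (p - q) = (1::real)" by (simp flip: powr_add)
    finally show ?thesis
      using mult_left_mono[OF lower[of \<beta>], of "q / p"] \<beta> True pq by simp
  next
    case False
    have "(\<integral>x. clamp_real 1 \<beta> (s * x / u) powr q - 1 \<partial>\<mu>) \<le> (\<integral>x. \<phi> x / u powr q \<partial>\<mu>)"
      using A by (intro integral_mono IA) (use I\<phi> in auto)
    also have "\<dots> = integral\<^sup>L \<mu> \<phi> / u powr q" by simp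
    also have "\<dots> \<le> (q / p * (2 powr p - 1)) * \<pi>"
      using \<kappa> by (intro order_trans[OF I\<phi>' mult_right_mono]) (auto simp: \<pi>_def)
    also have "\<dots> = q / p * ((2 powr p - 1) * \<pi>)" by simp
    also have "\<dots> \<le> q / p * (\<integral>x. clamp_real 1 \<beta> (x / u) powr p - 1 \<partial>\<mu>)"
      using lower[of 2] False pq by (intro mult_left_mono) auto
    finally show ?thesis .
  qed
  then show ?thesis by (simp add: eq)
qed

text \<open>
The deficit below the level \<open>v\<close>, dual to the excess above: for \<open>X\<close> it is at most \<open>1 - (a / v) powr p\<close> and
supported where \<open>X < v\<close>, while for \<open>s X\<close> it is bounded below on the much more likely event
\<open>s X \<le> v / 2\<close>. There the deficit is \<open>1 - d powr q\<close> with \<open>d = max (a / v) (1 / 2)\<close>, and the two possible values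
of \<open>d\<close> account for the constant in the hypothesis.
\<close>

lemma lower_truncation_le:
  assumes "real_distribution \<mu>" and pq: "0 < p" "p < q" and s: "0 < s" and v: "0 < a" "a \<le> v"
    and tail: "measure \<mu> {..<v} \<le> (p / q * (1 - (1/2) powr q)) * measure \<mu> {..v / (2 * s)}"
  shows "q / p * (\<integral>x. 1 - (clamp_real a v x / v) powr p \<partial>\<mu>) \<le> (\<integral>x. 1 - (clamp_real a v (s * x) / v) powr q \<partial>\<mu>)"
proof -
  interpret real_distribution \<mu> by fact
  have v0: "0 < v" using v by simp
  define \<alpha> where "\<alpha> = a / v"
  have \<alpha>: "0 < \<alpha>" "\<alpha> \<le> 1" using v v0 by (auto simp: \<alpha>_def)
  define \<pi> where "\<pi> = measure \<mu> {..v / (2 * s)}"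
  have eq: "clamp_real a v x / v = clamp_real \<alpha> 1 (x / v)" for x
    using v v0 by (auto simp: clamp_real_def \<alpha>_def max_def min_def field_simps)
  have cl: "\<alpha> \<le> clamp_real \<alpha> 1 x" "clamp_real \<alpha> 1 x \<le> 1" for x using \<alpha> by (auto simp: clamp_real_bounds)
  have cp: "\<alpha> powr t \<le> clamp_real \<alpha> 1 x powr t" "clamp_real \<alpha> 1 x powr t \<le> 1" if "0 < t" for x t
    using cl[of x] \<alpha> that by (auto intro!: powr_mono2 powr_le1)
  have IA: "integrable \<mu> (\<lambda>x. 1 - clamp_real \<alpha> 1 (s * x / v) powr q)"
    by (rule integral_between(3)[of _ 0 "1"]) (use cp[of q] pq in auto)
  have IB: "integrable \<mu> (\<lambda>x. 1 - clamp_real \<alpha> 1 (x / v) powr p)"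
    by (rule integral_between(3)[of _ 0 "1"]) (use cp[of p] pq in auto)
  define d where "d = max \<alpha> (1/2)"
  have d: "\<alpha> \<le> d" "1/2 \<le> d" "d \<le> 1" "0 < d" using \<alpha> by (auto simp: d_def)
  have "(\<integral>x. 1 - clamp_real \<alpha> 1 (x / v) powr p \<partial>\<mu>) \<le> (\<integral>x. (1 - \<alpha> powr p) * indicator {..<v} x \<partial>\<mu>)"
  proof (rule integral_mono[OF IB])
    fix x
    show "1 - clamp_real \<alpha> 1 (x / v) powr p \<le> (1 - \<alpha> powr p) * indicator {..<v} x"
      using cp[of p "x / v"] pq v0 \<alpha> by (auto simp: indicator_def clamp_real_def max_def min_def field_simps)
  qed (rule integrable_mult_indicator_const, simp)
  also have "\<dots> = (1 - \<alpha> powr p) * measure \<mu> {..<v}" by simp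
  also have "\<dots> \<le> (1 - \<alpha> powr p) * ((p / q * (1 - (1/2) powr q)) * \<pi>)"
    using tail \<alpha> pq by (intro mult_left_mono) (auto simp: \<pi>_def powr_le1)
  finally have "q / p * (\<integral>x. 1 - clamp_real \<alpha> 1 (x / v) powr p \<partial>\<mu>)
      \<le> q / p * ((1 - \<alpha> powr p) * ((p / q * (1 - (1/2) powr q)) * \<pi>))"
    using pq by (intro mult_left_mono) auto
  also have "\<dots> = ((1 - \<alpha> powr p) * (1 - (1/2) powr q)) * \<pi>" using pq by simp
  also have "\<dots> \<le> (1 - d powr q) * \<pi>"
  proof (rule mult_right_mono)
    have h: "0 \<le> (1/2::real) powr q" "(1/2::real) powr q \<le> 1" using pq by (auto intro: powr_le1)
    have g: "0 \<le> \<alpha> powr p" "\<alpha> powr p \<le> 1" using pq \<alpha> by (auto intro: powr_le1)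
    show "(1 - \<alpha> powr p) * (1 - (1/2) powr q) \<le> 1 - d powr q"
    proof (cases "1/2 \<le> \<alpha>")
      case True
      have "(1 - \<alpha> powr p) * (1 - (1/2) powr q) \<le> 1 - \<alpha> powr p" using h g by (intro mult_left_le) auto
      also have "\<dots> \<le> 1 - \<alpha> powr q" using powr_mono'[of p q \<alpha>] pq \<alpha> by simp
      finally show ?thesis using True by (simp add: d_def max_absorb1)
    next
      case False
      have "(1 - \<alpha> powr p) * (1 - (1/2) powr q) \<le> 1 - (1/2) powr q" using h g by (intro mult_left_le_one_le) auto
      then show ?thesis using False by (simp add: d_def max_absorb2)
    qed
  qed (simp add: \<pi>_def)
  also have "\<dots> = (\<integral>x. (1 - d powr q) * indicator {..v / (2 * s)} x \<partial>\<mu>)" by (simp add: \<pi>_def)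
  also have "\<dots> \<le> (\<integral>x. 1 - clamp_real \<alpha> 1 (s * x / v) powr q \<partial>\<mu>)"
  proof (rule integral_mono[OF _ IA])
    fix x
    have "clamp_real \<alpha> 1 (s * x / v) powr q \<le> d powr q" if "x \<le> v / (2 * s)"
    proof (rule powr_mono2)
      have "s * x / v \<le> 1 / 2" using that s v0 by (simp add: field_simps)
      then show "clamp_real \<alpha> 1 (s * x / v) \<le> d" using \<alpha>
        unfolding d_def clamp_real_def by (intro max.mono min.coboundedI2) auto
      show "0 \<le> clamp_real \<alpha> 1 (s * x / v)" using cl(1)[of "s * x / v"] \<alpha> by linarith
    qed (use pq in simp)
    then show "(1 - d powr q) * indicator {..v / (2 * s)} x \<le> 1 - clamp_real \<alpha> 1 (s * x / v) powr q"
      using cp(2)[of q "s * x / v"] pq by (auto simp: indicator_def)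
  qed (rule integrable_mult_indicator_const, simp)
  finally show ?thesis by (simp add: eq)
qed

text \<open>
Upper and lower parts are compared at a level \<open>u\<close> between \<open>a\<close> and \<open>b\<close>, the point of \<open>[a, b]\<close> closest to
\<open>t\<close>. If \<open>u > t\<close> then \<open>u = a\<close> and there is nothing below \<open>u\<close>; if \<open>u < t\<close> then \<open>u = b\<close> and there is nothing
above. Hence each tail condition is used only on the side of \<open>t\<close> where it holds. The two parts add up
linearly, and \<open>1 + r (B - 1) \<le> B powr r\<close> with \<open>r = q / p\<close> turns the linear comparison into the one of norms.
\<close>

lemma truncation_contractive_of_tails:
  assumes \<mu>: "moment_law q \<mu>" and pq: "0 < p" "p < q" and s: "0 < s" and t: "0 < t"
    and \<kappa>: "\<kappa> \<le> 2 powr (p - q)" "\<kappa> \<le> q / p * (2 powr p - 1)" "0 \<le> \<kappa>"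
    and upper: "\<And>u. t \<le> u \<Longrightarrow>
      (\<integral>x. \<bar>s * x\<bar> powr q * indicator {x. u < s * x} x \<partial>\<mu>) \<le> \<kappa> * u powr q * measure \<mu> {2 * u..}"
    and lower: "\<And>v. 0 < v \<Longrightarrow> v \<le> t \<Longrightarrow>
      measure \<mu> {..<v} \<le> (p / q * (1 - (1/2) powr q)) * measure \<mu> {..v / (2 * s)}"
  shows "truncation_contractive p q s \<mu>"
  unfolding truncation_contractive_def
proof (intro allI impI)
  fix a b :: real assume ab: "0 < a \<and> a \<le> b"
  interpret real_distribution \<mu> using \<mu> by (simp add: moment_law_def)
  define r where "r = q / p"
  have r: "1 \<le> r" "0 < r" "p * r = q" using pq by (auto simp: r_def)
  define u where "u = clamp_real a b t"
  have u: "0 < u" "a \<le> u" "u \<le> b" using ab by (auto simp: u_def clamp_real_def)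
  have at_u: "(clamp_real a b x / u) powr e - 1
      = ((clamp_real u b x / u) powr e - 1) - (1 - (clamp_real a u x / u) powr e)" for x e
    using u by (auto simp: clamp_real_def max_def min_def)
  have int: "integrable \<mu> (\<lambda>x. (clamp_real a' b' (h x) / u) powr e)"
    if "0 < a'" "a' \<le> b'" "0 < e" and [measurable]: "h \<in> borel_measurable borel" for a' b' e h
  proof (rule integral_between(3)[of _ 0 "(b' / u) powr e"])
    show "(clamp_real a' b' (h x) / u) powr e \<le> (b' / u) powr e" for x
      using that u clamp_real_bounds[of a' b' "h x"] by (intro powr_mono2) (auto intro!: divide_right_mono)
  qed (use u in auto)
  have up: "(\<integral>x. (clamp_real u b (s * x) / u) powr q - 1 \<partial>\<mu>) \<le> r * (\<integral>x. (clamp_real u b x / u) powr p - 1 \<partial>\<mu>)"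
  proof (cases "t \<le> u")
    case True
    show ?thesis unfolding r_def
      by (rule upper_truncation_le[OF \<mu> pq s u(1,3) \<kappa> upper[OF True]])
  next
    case False
    then have "u = b" using ab by (auto simp: u_def clamp_real_def max_def min_def split: if_splits)
    then show ?thesis using u by simp
  qed
  have lo: "r * (\<integral>x. 1 - (clamp_real a u x / u) powr p \<partial>\<mu>) \<le> (\<integral>x. 1 - (clamp_real a u (s * x) / u) powr q \<partial>\<mu>)"
  proof (cases "u \<le> t")
    case True
    show ?thesis unfolding r_def
      by (rule lower_truncation_le[OF _ pq s _ u(2) lower[OF u(1) True]]) (use \<mu> ab in \<open>auto simp: moment_law_def\<close>)
  next
    case False
    then have "u = a" using ab by (auto simp: u_def clamp_real_def max_def min_def split: if_splits)
    then show ?thesis using u by simp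
  qed
  define B where "B = (\<integral>x. (clamp_real a b x / u) powr p \<partial>\<mu>)"
  have B: "0 < B"
  proof -
    have "(a / u) powr p \<le> B" unfolding B_def
    proof (rule integral_between(1)[of _ _ "(b / u) powr p"])
      fix x
      have c: "a \<le> clamp_real a b x" "clamp_real a b x \<le> b" using ab by (auto simp: clamp_real_bounds)
      show "(a / u) powr p \<le> (clamp_real a b x / u) powr p"
        using c ab u pq by (intro powr_mono2 divide_right_mono) auto
      show "(clamp_real a b x / u) powr p \<le> (b / u) powr p"
        using c ab u pq by (intro powr_mono2 divide_right_mono) auto
    qed simp
    moreover have "0 < (a / u) powr p" using ab u by simp
    ultimately show ?thesis by linarith
  qed
  have ints: "integrable \<mu> (\<lambda>x. (clamp_real a b (s * x) / u) powr q)"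
    "integrable \<mu> (\<lambda>x. (clamp_real u b (s * x) / u) powr q)"
    "integrable \<mu> (\<lambda>x. (clamp_real a u (s * x) / u) powr q)"
    "integrable \<mu> (\<lambda>x. (clamp_real a b x / u) powr p)"
    "integrable \<mu> (\<lambda>x. (clamp_real u b x / u) powr p)"
    "integrable \<mu> (\<lambda>x. (clamp_real a u x / u) powr p)"
    using int[of _ _ q "\<lambda>x. s * x"] int[of _ _ p "\<lambda>x. x"] u ab pq by auto
  have one: "prob UNIV = 1" using prob_space by simp
  have "(\<integral>x. (clamp_real a b (s * x) / u) powr q \<partial>\<mu>) - 1 = (\<integral>x. (clamp_real a b (s * x) / u) powr q - 1 \<partial>\<mu>)"
    using ints by (simp add: one)
  also have "\<dots> = (\<integral>x. (clamp_real u b (s * x) / u) powr q - 1 \<partial>\<mu>) - (\<integral>x. 1 - (clamp_real a u (s * x) / u) powr q \<partial>\<mu>)"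
    by (subst at_u) (rule Bochner_Integration.integral_diff; use ints in simp)
  also have "\<dots> \<le> r * ((\<integral>x. (clamp_real u b x / u) powr p - 1 \<partial>\<mu>) - (\<integral>x. 1 - (clamp_real a u x / u) powr p \<partial>\<mu>))"
    using up lo by (simp add: right_diff_distrib)
  also have "(\<integral>x. (clamp_real u b x / u) powr p - 1 \<partial>\<mu>) - (\<integral>x. 1 - (clamp_real a u x / u) powr p \<partial>\<mu>)
      = (\<integral>x. (clamp_real a b x / u) powr p - 1 \<partial>\<mu>)"
    by (subst at_u, rule Bochner_Integration.integral_diff[symmetric]; use ints in simp)
  also have "\<dots> = B - 1" using ints by (simp add: one B_def)
  also have "r * (B - 1) \<le> B powr r - 1"
    using powr_above_tangent[of r 1 B] r B by simp
  finally have fin: "(\<integral>x. (clamp_real a b (s * x) / u) powr q \<partial>\<mu>) \<le> B powr r" by simp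
  have pos: "0 \<le> clamp_real a b x" for x using clamp_real_bounds(1)[of a b x] ab by linarith
  have e1: "(\<integral>x. (clamp_real a b (s * x) / u) powr q \<partial>\<mu>) = (\<integral>x. clamp_real a b (s * x) powr q \<partial>\<mu>) / u powr q"
    using pos u by (simp add: powr_divide)
  have e2: "B powr r = (\<integral>x. clamp_real a b x powr p \<partial>\<mu>) powr r / u powr q"
    using pos u by (simp add: B_def powr_divide powr_powr r)
  show "(\<integral>x. clamp_real a b (s * x) powr q \<partial>\<mu>) \<le> (\<integral>x. clamp_real a b x powr p \<partial>\<mu>) powr (q / p)"
    using fin u unfolding e1 e2 by (simp add: divide_le_cancel r_def)
qed

section \<open>Moments and tails of extrema\<close>

lemma integral_abs_powr_eq_law_norm:
  assumes "0 < t"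
  shows "(\<integral>x. \<bar>x\<bar> powr t \<partial>\<mu>) = law_norm t \<mu> powr t"
  using assms by (simp add: law_norm_def powr_powr integral_nonneg)

lemma law_norm_nonneg: "0 \<le> law_norm t \<mu>"
  by (simp add: law_norm_def)

lemma Markov_law:
  assumes "moment_law p \<mu>" "0 < p" "0 \<le> t"
  shows "t powr p * measure \<mu> {t<..} \<le> law_norm p \<mu> powr p"
proof -
  interpret real_distribution \<mu> using assms(1) by (simp add: moment_law_def)
  have "t powr p * measure \<mu> {t<..} = (\<integral>x. t powr p * indicator {t<..} x \<partial>\<mu>)" by simp
  also have "\<dots> \<le> (\<integral>x. \<bar>x\<bar> powr p \<partial>\<mu>)"
    using assms
    by (intro integral_mono integrable_mult_indicator_const) (auto simp: moment_law_def indicator_def intro!: powr_mono2)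
  finally show ?thesis using assms by (simp add: integral_abs_powr_eq_law_norm)
qed

lemma law_norm_pos_iff:
  assumes "moment_law p \<mu>" "0 < p"
  shows "0 < law_norm p \<mu> \<longleftrightarrow> 0 < measure \<mu> {0<..}"
proof -
  interpret real_distribution \<mu> using assms(1) by (simp add: moment_law_def)
  have I: "integrable \<mu> (\<lambda>x. \<bar>x\<bar> powr p)" and nn: "AE x in \<mu>. 0 \<le> x"
    using assms by (auto simp: moment_law_def)
  have "law_norm p \<mu> = 0 \<longleftrightarrow> (\<integral>x. \<bar>x\<bar> powr p \<partial>\<mu>) = 0"
    using assms by (simp add: law_norm_def)
  also have "\<dots> \<longleftrightarrow> (AE x in \<mu>. \<bar>x\<bar> powr p = 0)"
    by (rule integral_nonneg_eq_0_iff_AE[OF I]) simp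
  also have "\<dots> \<longleftrightarrow> (AE x in \<mu>. x \<notin> {0<..})"
    using nn by (intro iffI; (elim AE_mp)?) (auto elim!: AE_mp)
  also have "\<dots> \<longleftrightarrow> measure \<mu> {0<..} = 0"
    by (subst AE_iff_measurable[OF _ refl]) (auto simp: emeasure_eq_measure greaterThan_def)
  finally show ?thesis
    using law_norm_nonneg[of p \<mu>] measure_nonneg[of \<mu> "{0<..}"] by linarith
qed

text \<open>
If the norms of exponents \<open>p < q\<close> are comparable, then the moment of order \<open>p\<close> cannot come from values
far below \<open>\<parallel>W\<parallel>\<^sub>p\<close>, nor, because of the moment of order \<open>q\<close>, from values far above it. Splitting at
\<open>c \<parallel>W\<parallel>\<^sub>p\<close> and \<open>L \<parallel>W\<parallel>\<^sub>p\<close>, with \<open>c\<close> and \<open>L\<close> chosen so that each extreme range contributes at most a quarter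
of the moment, leaves a definite probability for values exceeding \<open>c \<parallel>W\<parallel>\<^sub>p\<close>. The constants
depend on \<open>p\<close>, \<open>q\<close> and \<open>C\<close> alone, hence serve all the laws of minima and maxima at once.
\<close>

lemma Paley_Zygmund_law:
  assumes pq: "0 < p" "p < q" and C: "0 < C"
  obtains c c0 :: real where "0 < c" "0 < c0"
    "\<And>\<mu>. moment_law q \<mu> \<Longrightarrow> law_norm q \<mu> \<le> C * law_norm p \<mu> \<Longrightarrow> 0 < law_norm p \<mu> \<Longrightarrow>
       c0 \<le> measure \<mu> {c * law_norm p \<mu><..}"
proof -
  define c where "c = (1/4 :: real) powr (1/p)"
  define L where "L = (4 * C powr q) powr (1 / (q - p))"
  define c0 where "c0 = 1 / (2 * L powr p)"
  have pos: "0 < c" "0 < L" "0 < c0" using C by (auto simp: c_def L_def c0_def)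
  have cp: "c powr p = 1/4" using pq by (simp add: c_def powr_powr)
  have Lp: "L powr (p - q) = 1 / (4 * C powr q)"
  proof -
    have "1 / (q - p) * (p - q) = -1" using pq by (simp add: field_simps)
    then show ?thesis using C by (simp add: L_def powr_powr powr_minus_divide)
  qed
  have "c0 \<le> measure \<mu> {c * law_norm p \<mu><..}"
    if \<mu>: "moment_law q \<mu>" and h: "law_norm q \<mu> \<le> C * law_norm p \<mu>" and \<tau>: "0 < law_norm p \<mu>" for \<mu>
  proof -
    interpret real_distribution \<mu> using \<mu> by (simp add: moment_law_def)
    define \<tau> where "\<tau> = law_norm p \<mu>"
    have \<tau>0: "0 < \<tau>" using \<tau> by (simp add: \<tau>_def)
    have Ip: "integrable \<mu> (\<lambda>x. \<bar>x\<bar> powr p)" and Iq: "integrable \<mu> (\<lambda>x. \<bar>x\<bar> powr q)" and nn: "AE x in \<mu>. 0 \<le> x"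
      using \<mu> moment_law_mono[OF \<mu>, of p] pq by (auto simp: moment_law_def)
    have one: "prob UNIV = 1" using prob_space by simp
    have Ii: "integrable \<mu> (\<lambda>x. (L * \<tau>) powr p * indicator {c * \<tau><..} x)"
      by (rule integrable_mult_indicator_const, simp)
    have "\<tau> powr p = (\<integral>x. \<bar>x\<bar> powr p \<partial>\<mu>)"
      using pq by (simp add: \<tau>_def integral_abs_powr_eq_law_norm)
    also have "\<dots> \<le> (\<integral>x. (c * \<tau>) powr p + (L * \<tau>) powr p * indicator {c * \<tau><..} x + \<bar>x\<bar> powr q * (L * \<tau>) powr (p - q) \<partial>\<mu>)"
    proof (rule integral_mono_AE)
      show "AE x in \<mu>. \<bar>x\<bar> powr p \<le> (c * \<tau>) powr p + (L * \<tau>) powr p * indicator {c * \<tau><..} x + \<bar>x\<bar> powr q * (L * \<tau>) powr (p - q)"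
        using nn
      proof eventually_elim
        fix x :: real assume x: "0 \<le> x"
        consider "x \<le> c * \<tau>" | "c * \<tau> < x" "x \<le> L * \<tau>" | "c * \<tau> < x" "L * \<tau> < x" by linarith
        then show "\<bar>x\<bar> powr p \<le> (c * \<tau>) powr p + (L * \<tau>) powr p * indicator {c * \<tau><..} x + \<bar>x\<bar> powr q * (L * \<tau>) powr (p - q)"
        proof cases
          case 1
          then have "\<bar>x\<bar> powr p \<le> (c * \<tau>) powr p" using x pq by (intro powr_mono2) auto
          then show ?thesis by (simp add: add_increasing2)
        next
          case 2
          then have "\<bar>x\<bar> powr p \<le> (L * \<tau>) powr p" using x pq by (intro powr_mono2) auto
          then show ?thesis using 2 by (simp add: add_increasing add_increasing2)
        next
          case 3
          then have x0: "0 < x" using pos \<tau>0 by (smt (verit) mult_pos_pos)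
          have "\<bar>x\<bar> powr p = \<bar>x\<bar> powr q * \<bar>x\<bar> powr (p - q)" using x0 by (simp flip: powr_add)
          also have "\<dots> \<le> \<bar>x\<bar> powr q * (L * \<tau>) powr (p - q)"
            using 3 pos \<tau>0 pq by (intro mult_left_mono powr_mono2') auto
          finally show ?thesis by (simp add: add_increasing)
        qed
      qed
    qed (use Ip Iq Ii in auto)
    also have "\<dots> = (c * \<tau>) powr p + (L * \<tau>) powr p * prob {c * \<tau><..} + law_norm q \<mu> powr q * (L * \<tau>) powr (p - q)"
      using Ii Iq pq by (simp add: one integral_abs_powr_eq_law_norm)
    also have "\<dots> \<le> (c * \<tau>) powr p + (L * \<tau>) powr p * prob {c * \<tau><..} + (C * \<tau>) powr q * (L * \<tau>) powr (p - q)"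
      using h pq law_norm_nonneg[of q \<mu>] by (intro add_left_mono mult_right_mono powr_mono2) (auto simp: \<tau>_def)
    also have "\<dots> = \<tau> powr p * (1/4 + L powr p * prob {c * \<tau><..} + 1/4)"
    proof -
      have "(C * \<tau>) powr q * (L * \<tau>) powr (p - q) = (C powr q * L powr (p - q)) * (\<tau> powr q * \<tau> powr (p - q))"
        using C \<tau>0 pos by (simp add: powr_mult)
      also have "\<tau> powr q * \<tau> powr (p - q) = \<tau> powr p" using \<tau>0 by (simp flip: powr_add)
      also have "C powr q * L powr (p - q) = 1/4" using C by (simp add: Lp)
      finally have eq: "(C * \<tau>) powr q * (L * \<tau>) powr (p - q) = 1/4 * \<tau> powr p" .
      show ?thesis unfolding eq using pos \<tau>0 by (simp add: powr_mult cp algebra_simps)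
    qed
    finally have "\<tau> powr p * 1 \<le> \<tau> powr p * (1/2 + L powr p * prob {c * \<tau><..})" by simp
    then have "1/2 \<le> L powr p * prob {c * \<tau><..}"
      using \<tau>0 by (subst (asm) mult_le_cancel_left_pos) auto
    then show ?thesis using pos by (simp add: c0_def \<tau>_def field_simps)
  qed
  then show thesis using that[of c c0] pos by blast
qed

lemma measure_pair_law:
  assumes "real_distribution \<mu>" "real_distribution \<nu>"
  shows "measure (pair_law max \<mu> \<nu>) {..t} = measure \<mu> {..t} * measure \<nu> {..t}"
    and "measure (pair_law min \<mu> \<nu>) {t<..} = measure \<mu> {t<..} * measure \<nu> {t<..}"
proof -
  interpret \<mu>: real_distribution \<mu> by fact
  interpret \<nu>: real_distribution \<nu> by fact
  interpret pair_prob_space \<mu> \<nu> ..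
  have 1: "(\<lambda>(x, y). max x y) -` {..t} \<inter> space (\<mu> \<Otimes>\<^sub>M \<nu>) = {..t} \<times> {..t}"
    and 2: "(\<lambda>(x, y). min x y) -` {t<..} \<inter> space (\<mu> \<Otimes>\<^sub>M \<nu>) = {t<..} \<times> {t<..}"
    by (auto simp: space_pair_measure)
  show "measure (pair_law max \<mu> \<nu>) {..t} = measure \<mu> {..t} * measure \<nu> {..t}"
    unfolding pair_law_def by (subst measure_distr) (auto simp: 1 measure_def \<nu>.emeasure_pair_measure_Times enn2real_mult)
  show "measure (pair_law min \<mu> \<nu>) {t<..} = measure \<mu> {t<..} * measure \<nu> {t<..}"
    unfolding pair_law_def by (subst measure_distr) (auto simp: 2 measure_def \<nu>.emeasure_pair_measure_Times enn2real_mult)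
qed

lemma measure_extremum_law:
  assumes "moment_law q \<mu>" "1 \<le> n"
  shows "measure (max_law n \<mu>) {..t} = measure \<mu> {..t} ^ n"
    and "measure (min_law n \<mu>) {t<..} = measure \<mu> {t<..} ^ n"
proof -
  have \<mu>: "real_distribution \<mu>" using assms by (simp add: moment_law_def)
  have ext: "real_distribution (max_law n \<mu>)" "real_distribution (min_law n \<mu>)" if "1 \<le> n" for n
    using moment_law_extremum[OF assms(1) that] by (auto simp: moment_law_def)
  show "measure (max_law n \<mu>) {..t} = measure \<mu> {..t} ^ n"
    using assms(2)
  proof (induction n rule: dec_induct)
    case base then show ?case using extremum_law_one[OF \<mu>] by simp
  next
    case (step n) then show ?case using extremum_law_Suc[OF \<mu>] measure_pair_law[OF \<mu>] ext[of n] by simp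
  qed
  show "measure (min_law n \<mu>) {t<..} = measure \<mu> {t<..} ^ n"
    using assms(2)
  proof (induction n rule: dec_induct)
    case base then show ?case using extremum_law_one[OF \<mu>] by simp
  next
    case (step n) then show ?case using extremum_law_Suc[OF \<mu>] measure_pair_law[OF \<mu>] ext[of n] by simp
  qed
qed

lemma (in real_distribution) prob_atMost_greaterThan: "prob {..t} = 1 - prob {t<..}"
proof -
  have "{..t} = space M - {t<..}" by auto
  then show ?thesis using prob_compl[of "{t<..}"] by simp
qed

text \<open>
The maximum contains each single copy on the event that this copy exceeds \<open>t\<close> and the other \<open>n - 1\<close>
copies do not, and these \<open>n\<close> events are disjoint. The induction adds the copies one at a time.
\<close>

lemma max_law_tail_moment:
  assumes \<mu>: "moment_law q \<mu>" and n: "1 \<le> n"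
  shows "real n * (\<integral>x. \<bar>x\<bar> powr q * indicator {t<..} x \<partial>\<mu>) * measure \<mu> {..t} ^ (n - 1)
    \<le> (\<integral>x. \<bar>x\<bar> powr q * indicator {t<..} x \<partial>max_law n \<mu>)"
  using n
proof (induction n rule: dec_induct)
  case base
  then show ?case using extremum_law_one(1)[of \<mu>] \<mu> by (simp add: moment_law_def)
next
  case (step n)
  define \<nu> where "\<nu> = max_law n \<mu>"
  have \<nu>: "moment_law q \<nu>" using moment_law_extremum[OF \<mu>] step by (simp add: \<nu>_def)
  interpret \<mu>: real_distribution \<mu> using \<mu> by (simp add: moment_law_def)
  interpret \<nu>: real_distribution \<nu> using \<nu> by (simp add: moment_law_def)
  interpret pair_prob_space \<mu> \<nu> ..
  define \<phi> where "\<phi> = (\<lambda>x::real. \<bar>x\<bar> powr q * indicator {t<..} x)"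
  have [measurable]: "\<phi> \<in> borel_measurable borel" unfolding \<phi>_def by measurable
  have \<phi>0: "0 \<le> \<phi> x" for x by (simp add: \<phi>_def)
  have I: "integrable \<rho> \<phi>" if "moment_law q \<rho>" for \<rho>
    unfolding \<phi>_def using that by (intro integrable_real_mult_indicator) (auto simp: moment_law_def real_distribution_def real_distribution_axioms_def)
  have "integrable (pair_law max \<mu> \<nu>) \<phi>"
    by (rule I[OF moment_law_pair_law[OF \<mu> \<nu>]]) simp
  then have I2: "integrable (\<mu> \<Otimes>\<^sub>M \<nu>) (\<lambda>(x, y). \<phi> (max x y))"
    unfolding pair_law_def by (subst (asm) integrable_distr_eq) (auto simp: case_prod_unfold)
  define e where "e = integral\<^sup>L \<mu> \<phi>"
  define F where "F = measure \<mu> {..t}"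
  have "real (Suc n) * e * F ^ n = e * F ^ n + real n * e * F ^ (n - 1) * F"
    using step by (cases n) (auto simp: algebra_simps)
  also have "\<dots> \<le> e * measure \<nu> {..t} + integral\<^sup>L \<nu> \<phi> * F"
    using step.IH measure_extremum_law(1)[OF \<mu>, of n t] step
    by (intro add_mono mult_right_mono) (auto simp: e_def \<phi>_def F_def \<nu>_def)
  also have "\<dots> = (\<integral>x. \<phi> x * measure \<nu> {..t} + indicator {..t} x * integral\<^sup>L \<nu> \<phi> \<partial>\<mu>)"
  proof -
    have "integrable \<mu> (\<lambda>x. indicator {..t} x * integral\<^sup>L \<nu> \<phi>)"
      using \<mu>.integrable_mult_indicator_const[of "{..t}" "integral\<^sup>L \<nu> \<phi>"] by (simp add: mult.commute)
    then show ?thesis using I[OF \<mu>] by (simp add: e_def F_def)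
  qed
  also have "\<dots> \<le> (\<integral>x. (\<integral>y. \<phi> (max x y) \<partial>\<nu>) \<partial>\<mu>)"
  proof (rule integral_mono)
    show "integrable \<mu> (\<lambda>x. \<phi> x * measure \<nu> {..t} + indicator {..t} x * integral\<^sup>L \<nu> \<phi>)"
      using I[OF \<mu>] \<mu>.integrable_mult_indicator_const[of "{..t}" "integral\<^sup>L \<nu> \<phi>"] by (simp add: mult.commute)
    show "integrable \<mu> (\<lambda>x. \<integral>y. \<phi> (max x y) \<partial>\<nu>)"
      using I2 by (rule integrable_fst)
    show "\<phi> x * measure \<nu> {..t} + indicator {..t} x * integral\<^sup>L \<nu> \<phi> \<le> (\<integral>y. \<phi> (max x y) \<partial>\<nu>)" for x
    proof -
      have Ii: "integrable \<nu> (\<lambda>y. \<phi> x * indicator {..t} y)"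
        by (rule \<nu>.integrable_mult_indicator_const, simp)
      have "\<phi> x * measure \<nu> {..t} + indicator {..t} x * integral\<^sup>L \<nu> \<phi>
          = (\<integral>y. \<phi> x * indicator {..t} y + indicator {..t} x * \<phi> y \<partial>\<nu>)"
        using Ii I[OF \<nu>] by simp
      also have "\<dots> \<le> (\<integral>y. \<phi> (max x y) \<partial>\<nu>)"
      proof (rule integral_mono)
        show "integrable \<nu> (\<lambda>y. \<phi> (max x y))"
        proof (rule Bochner_Integration.integrable_bound[of _ "\<lambda>y. \<phi> x + \<phi> y"])
          show "AE y in \<nu>. norm (\<phi> (max x y)) \<le> norm (\<phi> x + \<phi> y)"
            using \<phi>0 by (auto simp: max_def)
        qed (use I[OF \<nu>] in auto)
        show "\<phi> x * indicator {..t} y + indicator {..t} x * \<phi> y \<le> \<phi> (max x y)" for y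
          by (auto simp: \<phi>_def indicator_def max_def)
      qed (use Ii I[OF \<nu>] in auto)
      finally show ?thesis .
    qed
  qed
  also have "\<dots> = integral\<^sup>L (pair_law max \<mu> \<nu>) \<phi>"
  proof -
    show ?thesis using integral_fst[OF I2]
      unfolding pair_law_def by (subst integral_distr) (auto simp: case_prod_unfold)
  qed
  also have "pair_law max \<mu> \<nu> = max_law (Suc n) \<mu>"
    using extremum_law_Suc(1)[of \<mu> n] step \<mu> by (simp add: \<nu>_def moment_law_def)
  finally show ?case by (simp add: e_def F_def \<phi>_def)
qed

section \<open>Tails of hypercontractive laws\<close>

text \<open>
Positivity of a norm means that positive values have positive probability, which is passed on to
minima and maxima by the product formulas for their tails.
\<close>

lemma law_norm_extremum_pos:
  assumes "moment_law p \<mu>" "0 < p" "1 \<le> n" "0 < law_norm p \<mu>"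
  shows "0 < law_norm p (max_law n \<mu>)" "0 < law_norm p (min_law n \<mu>)"
proof -
  interpret real_distribution \<mu> using assms by (simp add: moment_law_def)
  note ext = moment_law_extremum[OF assms(1,3)]
  interpret M: real_distribution "max_law n \<mu>" using ext by (simp add: moment_law_def)
  have G: "0 < prob {0<..}" using assms law_norm_pos_iff by blast
  have "prob {..0} < 1" using G by (simp add: prob_atMost_greaterThan)
  then have "prob {..0} ^ n < 1" using assms(3) by (simp add: power_less_one_iff)
  then have "0 < measure (max_law n \<mu>) {0<..}"
    using measure_extremum_law(1)[OF assms(1,3), of 0] M.prob_atMost_greaterThan[of 0] by simp
  then show "0 < law_norm p (max_law n \<mu>)" using law_norm_pos_iff[OF ext(1) assms(2)] by simp
  show "0 < law_norm p (min_law n \<mu>)"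
    using law_norm_pos_iff[OF ext(2) assms(2)] measure_extremum_law(2)[OF assms(1,3), of 0] G by simp
qed

lemma Markov_law_half:
  assumes "moment_law p \<mu>" "0 < p" "0 < law_norm p \<mu>"
  shows "measure \<mu> {2 powr (1/p) * law_norm p \<mu><..} \<le> 1/2"
proof -
  have "(2 powr (1/p) * law_norm p \<mu>) powr p = 2 * law_norm p \<mu> powr p"
    using assms by (simp add: powr_mult powr_powr)
  then have "law_norm p \<mu> powr p * (2 * measure \<mu> {2 powr (1/p) * law_norm p \<mu><..}) \<le> law_norm p \<mu> powr p * 1"
    using Markov_law[of p \<mu> "2 powr (1/p) * law_norm p \<mu>"] assms by (simp add: mult_ac)
  then show ?thesis using assms(3) by (subst (asm) mult_le_cancel_left_pos) auto
qed

lemma mult_le_const_imp_nonpos: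
  fixes x K :: real
  assumes "\<And>n::nat. 1 \<le> n \<Longrightarrow> real n * x \<le> K"
  shows "x \<le> 0"
proof (rule ccontr)
  assume "\<not> x \<le> 0"
  then obtain n :: nat where "K < real n * x" using reals_Archimedean3[of x] by auto
  moreover have "K < real (Suc n) * x" using calculation \<open>\<not> x \<le> 0\<close> by (simp add: algebra_simps)
  ultimately show False using assms[of "Suc n"] by simp
qed

text \<open>
Let \<open>\<tau> n\<close> be the norm of exponent \<open>p\<close> of the minimum of \<open>n\<close> copies. By Paley--Zygmund the minimum exceeds
\<open>c \<tau> n\<close> with probability at least \<open>c0\<close>, hence \<open>P (X \<le> c \<tau> n)\<close> is at most of order \<open>1 / n\<close>; by Markov's
inequality it exceeds \<open>A \<tau> n\<close> with probability at most \<open>1 / 2\<close>, hence \<open>P (X \<le> A \<tau> n)\<close> is at least of order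
\<open>1 / n\<close>. Comparing \<open>J n\<close> copies at the first level with \<open>n\<close> copies at the second gains a factor \<open>J\<close>, as
large as desired, while \<open>\<tau> (J n)\<close> stays comparable to \<open>\<tau> n\<close>. Thus dividing the level by a large constant
makes the lower tail drop by any prescribed factor.
\<close>

lemma min_hypercontractive_lower_tail:
  assumes \<mu>: "moment_law q \<mu>" and pq: "0 < p" "p < q" and C: "0 < C" and \<kappa>: "0 < \<kappa>"
    and pos: "0 < law_norm p \<mu>"
    and hyp: "\<And>n. 1 \<le> n \<Longrightarrow> law_norm q (min_law n \<mu>) \<le> C * law_norm p (min_law n \<mu>)"
  shows "\<exists>t>0. \<exists>s0>0. \<forall>s v. 0 < s \<and> s \<le> s0 \<and> 0 < v \<and> v \<le> t \<longrightarrow>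
    measure \<mu> {..<v} \<le> \<kappa> * measure \<mu> {..v / (2 * s)}"
proof -
  interpret real_distribution \<mu> using \<mu> by (simp add: moment_law_def)
  have \<mu>p: "moment_law p \<mu>" using moment_law_mono[OF \<mu>] pq by simp
  obtain c c0 where c: "0 < c" "0 < c0" and PZ: "\<And>\<mu>. moment_law q \<mu> \<Longrightarrow>
      law_norm q \<mu> \<le> C * law_norm p \<mu> \<Longrightarrow> 0 < law_norm p \<mu> \<Longrightarrow> c0 \<le> measure \<mu> {c * law_norm p \<mu><..}"
    using Paley_Zygmund_law[OF pq C] by metis
  define A where "A = (2::real) powr (1/p)"
  define \<tau> where "\<tau> = (\<lambda>n. law_norm p (min_law n \<mu>))"
  have A: "0 < A" by (simp add: A_def)
  have \<tau>: "0 < \<tau> n" if "1 \<le> n" for n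
    using law_norm_extremum_pos(2)[OF \<mu>p pq(1) that pos] by (simp add: \<tau>_def)
  have G: "c0 \<le> prob {c * \<tau> n<..} ^ n" if "1 \<le> n" for n
    using PZ[OF moment_law_extremum(2)[OF \<mu> that] hyp[OF that]] \<tau>[OF that]
    by (simp add: \<tau>_def measure_extremum_law(2)[OF \<mu> that])
  \<comment> \<open>from \<open>c0 \<le> (1 - f) ^ n\<close> and \<open>(1 - f) ^ n * (1 + n * f) \<le> 1\<close>\<close>
  have up: "real n * prob {..c * \<tau> n} \<le> 1 / c0" if n: "1 \<le> n" for n
  proof -
    define f where "f = prob {..c * \<tau> n}"
    have f: "0 \<le> f" "f \<le> 1" by (auto simp: f_def)
    have "c0 * (1 + real n * f) \<le> (1 - f) ^ n * (1 + f) ^ n"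
    proof (rule mult_mono)
      show "c0 \<le> (1 - f) ^ n" using G[OF n] by (simp add: f_def prob_atMost_greaterThan)
      show "1 + real n * f \<le> (1 + f) ^ n" using Bernoulli_inequality[of f n] f by simp
    qed (use f in auto)
    also have "\<dots> = (1 - f\<^sup>2) ^ n" by (simp add: power2_eq_square algebra_simps flip: power_mult_distrib)
    also have "\<dots> \<le> 1" using f by (intro power_le_one) (auto simp: power_le_one)
    finally have "c0 * (real n * f) \<le> 1" using c by (simp add: distrib_left)
    then show ?thesis using c by (simp add: f_def field_simps)
  qed
  have lo: "1 / 2 \<le> real n * prob {..A * \<tau> n}" if n: "1 \<le> n" for n
  proof -
    define f where "f = prob {..A * \<tau> n}"
    have f: "0 \<le> f" "f \<le> 1" by (auto simp: f_def)
    have "(1 - f) ^ n \<le> 1 / 2"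
      using Markov_law_half[OF moment_law_extremum(2)[OF \<mu>p n] pq(1)] \<tau>[OF n]
      by (simp add: \<tau>_def measure_extremum_law(2)[OF \<mu> n] A_def f_def prob_atMost_greaterThan)
    then show ?thesis using Bernoulli_inequality[of "-f" n] f by (simp add: f_def)
  qed
  obtain J :: nat where J: "4 / (c0 * \<kappa>) \<le> real J" "1 \<le> J"
  proof -
    obtain j :: nat where "4 / (c0 * \<kappa>) \<le> real j" using real_arch_simple by blast
    then show thesis by (intro that[of "Suc j"]) auto
  qed
  define d where "d = c * (c0 ^ J) powr (1/p)"
  have d: "0 < d" using c by (simp add: d_def)
  \<comment> \<open>a minimum of \<open>J * n\<close> copies is a minimum of \<open>J\<close> copies of a minimum of \<open>n\<close>, each of which is large with probability at least \<open>c0\<close>\<close>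
  have decay: "d * \<tau> n \<le> \<tau> (J * n)" if n: "1 \<le> n" for n
  proof -
    have Jn: "1 \<le> J * n" using J n by simp
    have "c0 ^ J \<le> (prob {c * \<tau> n<..} ^ n) ^ J" using G[OF n] c by (intro power_mono) auto
    also have "\<dots> = measure (min_law (J * n) \<mu>) {c * \<tau> n<..}"
      by (simp add: measure_extremum_law(2)[OF \<mu> Jn] mult.commute flip: power_mult)
    finally have "(c * \<tau> n) powr p * c0 ^ J \<le> (c * \<tau> n) powr p * measure (min_law (J * n) \<mu>) {c * \<tau> n<..}"
      by (intro mult_left_mono) auto
    also have "\<dots> \<le> \<tau> (J * n) powr p"
      using Markov_law[OF moment_law_extremum(2)[OF \<mu>p Jn] pq(1), of "c * \<tau> n"] c \<tau>[OF n] by (simp add: \<tau>_def)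
    finally have "((c * \<tau> n) powr p * c0 ^ J) powr (1/p) \<le> (\<tau> (J * n) powr p) powr (1/p)"
      using c pq by (intro powr_mono2) auto
    then show ?thesis using c pq \<tau>[OF n] \<tau>[OF Jn] by (simp add: powr_mult powr_powr d_def mult_ac)
  qed
  define t where "t = c * \<tau> J"
  define s0 where "s0 = c * d / (2 * A)"
  have main: "prob {..<v} \<le> \<kappa> * prob {..v / (2 * s)}" if s: "0 < s" "s \<le> s0" and v: "0 < v" "v \<le> t" for s v
  proof -
    have bound: "real m * prob {..<v} \<le> 1 / (c0 * real J)" if "1 \<le> m" "v \<le> c * \<tau> (J * m)" for m
    proof -
      have "real m * prob {..<v} \<le> real m * prob {..c * \<tau> (J * m)}"
        using that by (intro mult_left_mono finite_measure_mono) auto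
      also have "\<dots> \<le> 1 / (c0 * real J)"
        using up[of "J * m"] J that c by (simp add: field_simps)
      finally show ?thesis .
    qed
    \<comment> \<open>In the first case \<open>v\<close> lies below all the levels and there is no mass below \<open>v\<close>; otherwise \<open>v\<close> lies between two consecutive levels.\<close>
    show ?thesis
    proof (cases "\<forall>n\<ge>1. v \<le> c * \<tau> (J * n)")
      case True
      then have "prob {..<v} \<le> 0" using bound by (intro mult_le_const_imp_nonpos) auto
      then show ?thesis using \<kappa> by (smt (verit) measure_nonneg mult_nonneg_nonneg)
    next
      case False
      define n where "n = (LEAST n. 1 \<le> n \<and> c * \<tau> (J * n) < v)"
      have ex: "\<exists>n. 1 \<le> n \<and> c * \<tau> (J * n) < v" using False by (auto simp: not_le)
      have n: "1 \<le> n" "c * \<tau> (J * n) < v" using LeastI_ex[OF ex] by (auto simp: n_def)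
      have "n \<noteq> 1" using n v by (auto simp: t_def)
      then obtain m where m: "n = Suc m" "1 \<le> m" using n by (cases n) auto
      have "v \<le> c * \<tau> (J * m)"
        using not_less_Least[of m "\<lambda>n. 1 \<le> n \<and> c * \<tau> (J * n) < v"] m by (auto simp: n_def)
      then have "real m * prob {..<v} \<le> 1 / (c0 * real J)" using bound m by simp
      also have "\<dots> \<le> \<kappa> / 4" using J c \<kappa> by (simp add: field_simps)
      also have "\<dots> \<le> real m * (\<kappa> * prob {..A * \<tau> n})"
      proof -
        have "real n * prob {..A * \<tau> n} \<le> (2 * real m) * prob {..A * \<tau> n}"
          using m by (intro mult_right_mono) auto
        then have "1 / 4 \<le> real m * prob {..A * \<tau> n}" using lo[OF n(1)] by simp
        then have "\<kappa> * (1 / 4) \<le> \<kappa> * (real m * prob {..A * \<tau> n})" using \<kappa> by (intro mult_left_mono) auto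
        then show ?thesis by (simp add: mult_ac)
      qed
      finally have "prob {..<v} \<le> \<kappa> * prob {..A * \<tau> n}" using m by (subst (asm) mult_le_cancel_left_pos) auto
      also have "\<dots> \<le> \<kappa> * prob {..v / (2 * s)}"
      proof -
        have "2 * s * A \<le> c * d" using s(2) A by (simp add: s0_def field_simps)
        then have "2 * s * A * \<tau> n \<le> c * d * \<tau> n" using \<tau>[OF n(1)] by (intro mult_right_mono) auto
        also have "\<dots> \<le> c * \<tau> (J * n)" using decay[OF n(1)] c by (simp add: mult.assoc)
        also have "\<dots> \<le> v" using n by simp
        finally have "A * \<tau> n \<le> v / (2 * s)" using s by (simp add: field_simps)
        then show ?thesis using \<kappa> by (intro mult_left_mono finite_measure_mono) auto
      qed
      finally show ?thesis .
    qed
  qed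
  have "0 < t" "0 < s0" using c \<tau>[OF J(2)] d A by (auto simp: t_def s0_def)
  then show ?thesis using main by blast
qed

text \<open>
Let \<open>\<theta> n\<close> be the norm of exponent \<open>p\<close> of the maximum of \<open>n\<close> copies. Paley--Zygmund gives
\<open>P (X > c \<theta> n) \<ge> c0 / n\<close>. In the other direction, \<open>n E (X\<^sup>q; X > A \<theta> n)\<close> is at most of the order of the
moment of order \<open>q\<close> of the maximum, because each copy dominates the others with probability at least
\<open>1 / 2\<close> once it exceeds \<open>A \<theta> n\<close>; hypercontractivity bounds that moment by a multiple of \<open>\<theta> n powr q\<close>. A level
\<open>2 u\<close> between \<open>c \<theta> n\<close> and \<open>c \<theta> (n + 1)\<close> therefore satisfies the claim up to a constant \<open>K\<close>, and the factor
\<open>s powr q\<close> gained by scaling absorbs \<open>K\<close>. Levels below \<open>c \<theta> 1\<close> are harmless, since they stay above \<open>t\<close> and their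
tail has probability at least \<open>c0\<close>.
\<close>

lemma max_hypercontractive_upper_tail:
  assumes \<mu>: "moment_law q \<mu>" and pq: "0 < p" "p < q" and C: "0 < C" and \<kappa>: "0 < \<kappa>"
    and pos: "0 < law_norm p \<mu>"
    and hyp: "\<And>n. 1 \<le> n \<Longrightarrow> law_norm q (max_law n \<mu>) \<le> C * law_norm p (max_law n \<mu>)"
    and t: "0 < t"
  shows "\<exists>s0>0. \<forall>s u. 0 < s \<and> s \<le> s0 \<and> t \<le> u \<longrightarrow>
      (\<integral>x. \<bar>s * x\<bar> powr q * indicator {x. u < s * x} x \<partial>\<mu>) \<le> \<kappa> * u powr q * measure \<mu> {2 * u..}"
proof -
  interpret real_distribution \<mu> using \<mu> by (simp add: moment_law_def)
  have \<mu>p: "moment_law p \<mu>" using moment_law_mono[OF \<mu>] pq by simp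
  have q: "0 < q" using pq by simp
  have Iq: "integrable \<mu> (\<lambda>x. \<bar>x\<bar> powr q)" using \<mu> by (simp add: moment_law_def)
  obtain c c0 where c: "0 < c" "0 < c0" and PZ: "\<And>\<mu>. moment_law q \<mu> \<Longrightarrow>
      law_norm q \<mu> \<le> C * law_norm p \<mu> \<Longrightarrow> 0 < law_norm p \<mu> \<Longrightarrow> c0 \<le> measure \<mu> {c * law_norm p \<mu><..}"
    using Paley_Zygmund_law[OF pq C] by metis
  define A where "A = (2::real) powr (1/p)"
  define \<theta> where "\<theta> = (\<lambda>n. law_norm p (max_law n \<mu>))"
  define e where "e = (\<lambda>w. \<integral>x. \<bar>x\<bar> powr q * indicator {w<..} x \<partial>\<mu>)"
  define m where "m = (\<integral>x. \<bar>x\<bar> powr q \<partial>\<mu>)"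
  have A: "0 < A" by (simp add: A_def)
  have m: "0 \<le> m" by (simp add: m_def)
  have Ie: "integrable \<mu> (\<lambda>x. \<bar>x\<bar> powr q * indicator {w<..} x)" for w
    by (intro integrable_real_mult_indicator Iq) simp
  have e: "0 \<le> e w" "e w \<le> m" for w
  proof -
    show "0 \<le> e w" unfolding e_def by simp
    show "e w \<le> m" unfolding e_def m_def by (rule integral_mono[OF Ie Iq]) (simp add: indicator_def)
  qed
  have e_mono: "e w' \<le> e w" if "w \<le> w'" for w w'
    unfolding e_def by (rule integral_mono[OF Ie Ie]) (use that in \<open>simp add: indicator_def\<close>)
  have \<theta>: "0 < \<theta> n" if "1 \<le> n" for n
    using law_norm_extremum_pos(1)[OF \<mu>p pq(1) that pos] by (simp add: \<theta>_def)
  have G: "c0 \<le> real n * prob {c * \<theta> n<..}" if n: "1 \<le> n" for n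
  proof -
    interpret M: real_distribution "max_law n \<mu>"
      using moment_law_extremum(1)[OF \<mu> n] by (simp add: moment_law_def)
    have "c0 \<le> measure (max_law n \<mu>) {c * \<theta> n<..}"
      using PZ[OF moment_law_extremum(1)[OF \<mu> n] hyp[OF n]] \<theta>[OF n] by (simp add: \<theta>_def)
    also have "\<dots> = 1 - (1 - prob {c * \<theta> n<..}) ^ n"
      using M.prob_atMost_greaterThan[of "c * \<theta> n"]
      by (simp add: measure_extremum_law(1)[OF \<mu> n] prob_atMost_greaterThan)
    also have "\<dots> \<le> real n * prob {c * \<theta> n<..}"
      using Bernoulli_inequality[of "- prob {c * \<theta> n<..}" n] by simp
    finally show ?thesis .
  qed
  have tail: "real n * e (A * \<theta> n) \<le> 2 * C powr q * \<theta> n powr q" if n: "1 \<le> n" for n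
  proof -
    have Mn: "moment_law q (max_law n \<mu>)" by (rule moment_law_extremum(1)[OF \<mu> n])
    interpret M: real_distribution "max_law n \<mu>" using Mn by (simp add: moment_law_def)
    define F where "F = prob {..A * \<theta> n}"
    have F: "0 \<le> F" "F \<le> 1" by (auto simp: F_def)
    have "F ^ n = 1 - measure (max_law n \<mu>) {A * \<theta> n<..}"
      using M.prob_atMost_greaterThan[of "A * \<theta> n"] by (simp add: measure_extremum_law(1)[OF \<mu> n] F_def)
    then have "1/2 \<le> F ^ n"
      using Markov_law_half[OF moment_law_extremum(1)[OF \<mu>p n] pq(1)] \<theta>[OF n] by (simp add: \<theta>_def A_def)
    also have "\<dots> \<le> F ^ (n - 1)" using F by (intro power_decreasing) auto
    finally have "real n * e (A * \<theta> n) * (1/2) \<le> real n * e (A * \<theta> n) * F ^ (n - 1)"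
      using e by (intro mult_left_mono) auto
    also have "\<dots> \<le> (\<integral>x. \<bar>x\<bar> powr q * indicator {A * \<theta> n<..} x \<partial>max_law n \<mu>)"
      using max_law_tail_moment[OF \<mu> n, of "A * \<theta> n"] by (simp add: e_def F_def)
    also have "\<dots> \<le> (\<integral>x. \<bar>x\<bar> powr q \<partial>max_law n \<mu>)"
      using Mn by (intro integral_mono integrable_real_mult_indicator) (auto simp: moment_law_def indicator_def)
    also have "\<dots> = law_norm q (max_law n \<mu>) powr q" using q by (rule integral_abs_powr_eq_law_norm)
    also have "\<dots> \<le> (C * \<theta> n) powr q"
      using hyp[OF n] q law_norm_nonneg by (intro powr_mono2) (auto simp: \<theta>_def)
    also have "\<dots> = C powr q * \<theta> n powr q" using C \<theta>[OF n] by (simp add: powr_mult)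
    finally show ?thesis by simp
  qed
  define K where "K = 4 / c0 * C powr q * (2 / c) powr q"
  have K: "0 < K" using c C by (simp add: K_def)
  \<comment> \<open>\<open>s1\<close> serves the levels below \<open>c * \<theta> 1\<close>, \<open>s2\<close> those between two consecutive \<open>c * \<theta> n\<close>; adding \<open>1\<close> to \<open>m\<close> avoids a division by zero\<close>
  define s1 where "s1 = (\<kappa> * t powr q * c0 / (m + 1)) powr (1/q)"
  define s2 where "s2 = (\<kappa> / K) powr (1/q)"
  define s0 where "s0 = min (c / (2 * A)) (min s1 s2)"
  have s0: "0 < s0" using c A t \<kappa> m K by (auto simp: s0_def s1_def s2_def)
  have main: "(\<integral>x. \<bar>s * x\<bar> powr q * indicator {x. u < s * x} x \<partial>\<mu>) \<le> \<kappa> * u powr q * prob {2 * u..}"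
    if s: "0 < s" "s \<le> s0" and u: "t \<le> u" for s u
  proof -
    have u0: "0 < u" using u t by simp
    have "{x. u < s * x} = {u / s<..}" using s by (auto simp: field_simps)
    then have eq: "(\<integral>x. \<bar>s * x\<bar> powr q * indicator {x. u < s * x} x \<partial>\<mu>) = s powr q * e (u / s)"
      using s by (simp add: e_def abs_mult powr_mult mult.assoc)
    have s1: "s powr q * (m + 1) \<le> \<kappa> * t powr q * c0"
    proof -
      have "s powr q \<le> s1 powr q" using s q by (intro powr_mono2) (auto simp: s0_def)
      also have "\<dots> = \<kappa> * t powr q * c0 / (m + 1)" using q \<kappa> t c m by (simp add: s1_def powr_powr)
      finally show ?thesis using m by (simp add: field_simps)
    qed
    have s2: "s powr q * K \<le> \<kappa>"
    proof -
      have "s powr q \<le> s2 powr q" using s q by (intro powr_mono2) (auto simp: s0_def)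
      also have "\<dots> = \<kappa> / K" using q \<kappa> K by (simp add: s2_def powr_powr)
      finally show ?thesis using K by (simp add: field_simps)
    qed
    have scale: "e (u / s) \<le> e (A * \<theta> n)" if "c * \<theta> n \<le> 2 * u" "1 \<le> n" for n
    proof (rule e_mono)
      have "s \<le> c / (2 * A)" using s by (simp add: s0_def)
      then have "s * (2 * A) \<le> c" using A by (simp add: field_simps)
      then have "s * (2 * A) * \<theta> n \<le> c * \<theta> n" using \<theta>[OF that(2)] by (intro mult_right_mono) auto
      then show "A * \<theta> n \<le> u / s" using that s by (simp add: field_simps)
    qed
    have tail': "real n * e (u / s) \<le> 2 * C powr q * ((2 / c) powr q * u powr q)" if "c * \<theta> n \<le> 2 * u" "1 \<le> n" for n
    proof -
      have "\<theta> n powr q \<le> (2 / c * u) powr q"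
        using that c q \<theta>[OF that(2)] by (intro powr_mono2) (auto simp: field_simps)
      also have "\<dots> = (2 / c) powr q * u powr q" using c u0 by (simp only: powr_mult)
      finally have \<theta>u: "\<theta> n powr q \<le> (2 / c) powr q * u powr q" .
      have "real n * e (u / s) \<le> real n * e (A * \<theta> n)" using scale[OF that] by (intro mult_left_mono) auto
      also have "\<dots> \<le> 2 * C powr q * \<theta> n powr q" by (rule tail[OF that(2)])
      also have "\<dots> \<le> 2 * C powr q * ((2 / c) powr q * u powr q)" using \<theta>u by (intro mult_left_mono) auto
      finally show ?thesis .
    qed
    have "s powr q * e (u / s) \<le> \<kappa> * u powr q * prob {2 * u..}"
    \<comment> \<open>In the first case the variable is essentially bounded and \<open>u / s\<close> exceeds its bound.\<close>
    proof (cases "\<forall>n\<ge>1. c * \<theta> n \<le> 2 * u")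
      case True
      then have "e (u / s) \<le> 0" using tail' by (intro mult_le_const_imp_nonpos) auto
      then have "s powr q * e (u / s) \<le> 0" by (simp add: mult_nonneg_nonpos)
      also have "0 \<le> \<kappa> * u powr q * prob {2 * u..}" using \<kappa> by simp
      finally show ?thesis .
    next
      case False
      define n where "n = (LEAST n. 1 \<le> n \<and> 2 * u < c * \<theta> n)"
      have ex: "\<exists>n. 1 \<le> n \<and> 2 * u < c * \<theta> n" using False by (auto simp: not_le)
      have n: "1 \<le> n" "2 * u < c * \<theta> n" using LeastI_ex[OF ex] by (auto simp: n_def)
      have "c0 \<le> real n * prob {c * \<theta> n<..}" by (rule G[OF n(1)])
      also have "\<dots> \<le> real n * prob {2 * u..}"
        using n by (intro mult_left_mono finite_measure_mono) auto
      finally have P: "c0 \<le> real n * prob {2 * u..}" .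
      show ?thesis
      proof (cases "n = 1")
        case True
        have "s powr q * e (u / s) \<le> s powr q * (m + 1)"
          using e(2)[of "u / s"] by (intro mult_left_mono) auto
        also have "\<dots> \<le> \<kappa> * t powr q * c0" by (rule s1)
        also have "\<dots> \<le> \<kappa> * u powr q * prob {2 * u..}"
          using \<kappa> t u q c P True by (intro mult_mono powr_mono2) auto
        finally show ?thesis .
      next
        case False
        then obtain k where k: "n = Suc k" "1 \<le> k" using n by (cases n) auto
        have "c * \<theta> k \<le> 2 * u"
          using not_less_Least[of k "\<lambda>n. 1 \<le> n \<and> 2 * u < c * \<theta> n"] k by (auto simp: n_def)
        then have "real k * e (u / s) \<le> 2 * C powr q * ((2 / c) powr q * u powr q)" using tail' k by simp
        also have "\<dots> = K * u powr q * c0 / 2" using c by (simp add: K_def)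
        also have "\<dots> \<le> K * u powr q * (2 * real k * prob {2 * u..}) / 2"
        proof -
          have "real n * prob {2 * u..} \<le> 2 * real k * prob {2 * u..}" using k by (intro mult_right_mono) auto
          then show ?thesis using P K by (intro divide_right_mono mult_left_mono) auto
        qed
        also have "\<dots> = real k * (K * u powr q * prob {2 * u..})" by simp
        finally have "e (u / s) \<le> K * u powr q * prob {2 * u..}" using k by (subst (asm) mult_le_cancel_left_pos) auto
        then have "s powr q * e (u / s) \<le> s powr q * (K * u powr q * prob {2 * u..})" by (intro mult_left_mono) auto
        also have "\<dots> = (s powr q * K) * (u powr q * prob {2 * u..})" by simp
        also have "\<dots> \<le> \<kappa> * (u powr q * prob {2 * u..})" using s2 by (intro mult_right_mono) auto
        finally show ?thesis by (simp add: mult.assoc)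
      qed
    qed
    then show ?thesis using eq by simp
  qed
  show ?thesis using s0 main by blast
qed

text \<open>
The lower tail lemma is used first, since it produces the level \<open>t\<close> that separates the two tails, and
the upper tail lemma works for every positive \<open>t\<close>. The case of vanishing norm is that of
\<open>X = 0\<close> almost surely, where all truncations are constant.
\<close>

lemma hypercontractive_imp_truncation_contractive:
  assumes \<mu>: "moment_law q \<mu>" and pq: "0 < p" "p < q"
    and mn: "min_hypercontractive p q \<mu>" and mx: "max_hypercontractive p q \<mu>"
  shows "\<exists>s>0. truncation_contractive p q s \<mu>"
proof (cases "0 < law_norm p \<mu>")
  case True
  obtain C1 C2 :: real where C12: "\<And>n. 1 \<le> n \<Longrightarrow> law_norm q (min_law n \<mu>) \<le> C1 * law_norm p (min_law n \<mu>)"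
    "\<And>n. 1 \<le> n \<Longrightarrow> law_norm q (max_law n \<mu>) \<le> C2 * law_norm p (max_law n \<mu>)"
    using mn mx unfolding min_hypercontractive_def max_hypercontractive_def by blast
  define C where "C = max 1 (max C1 C2)"
  have C: "0 < C" "C1 \<le> C" "C2 \<le> C" by (auto simp: C_def)
  have hmin: "law_norm q (min_law n \<mu>) \<le> C * law_norm p (min_law n \<mu>)" if "1 \<le> n" for n
    by (rule order_trans[OF C12(1)[OF that] mult_right_mono[OF C(2) law_norm_nonneg]])
  have hmax: "law_norm q (max_law n \<mu>) \<le> C * law_norm p (max_law n \<mu>)" if "1 \<le> n" for n
    by (rule order_trans[OF C12(2)[OF that] mult_right_mono[OF C(3) law_norm_nonneg]])
  define \<kappa> where "\<kappa> = min (2 powr (p - q)) (q / p * (2 powr p - 1))"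
  have "(1::real) < 2 powr p" using pq by simp
  then have \<kappa>: "0 < \<kappa>" "\<kappa> \<le> 2 powr (p - q)" "\<kappa> \<le> q / p * (2 powr p - 1)"
    using pq unfolding \<kappa>_def by (auto intro!: mult_pos_pos divide_pos_pos)
  have "(1/2::real) powr q < 1" using pq by (intro powr01_less_one[THEN iffD2]) auto
  then have \<kappa>': "0 < p / q * (1 - (1/2) powr q)" using pq by simp
  obtain t s1 where t: "0 < t" "0 < s1" and lower:
    "\<forall>s v. 0 < s \<and> s \<le> s1 \<and> 0 < v \<and> v \<le> t \<longrightarrow>
      measure \<mu> {..<v} \<le> (p / q * (1 - (1/2) powr q)) * measure \<mu> {..v / (2 * s)}"
    using min_hypercontractive_lower_tail[OF \<mu> pq C(1) \<kappa>' True hmin] by auto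
  obtain s2 where s2: "0 < s2" and upper: "\<forall>s u. 0 < s \<and> s \<le> s2 \<and> t \<le> u \<longrightarrow>
      (\<integral>x. \<bar>s * x\<bar> powr q * indicator {x. u < s * x} x \<partial>\<mu>) \<le> \<kappa> * u powr q * measure \<mu> {2 * u..}"
    using max_hypercontractive_upper_tail[OF \<mu> pq C(1) \<kappa>(1) True hmax t(1)] by auto
  define s where "s = min s1 s2"
  have s: "0 < s" "s \<le> s1" "s \<le> s2" using t s2 by (auto simp: s_def)
  have "truncation_contractive p q s \<mu>"
    by (rule truncation_contractive_of_tails[OF \<mu> pq s(1) t(1) \<kappa>(2,3)])
       (use \<kappa> upper lower s in auto)
  then show ?thesis using s by blast
next
  case False
  interpret real_distribution \<mu> using \<mu> by (simp add: moment_law_def)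
  have "prob {0<..} = 0"
    using False law_norm_pos_iff[OF moment_law_mono[OF \<mu>], of p] pq measure_nonneg[of \<mu> "{0<..}"] by linarith
  then have AE: "AE x in \<mu>. x \<le> 0"
    by (subst AE_iff_measurable[of "{0<..}"]) (auto simp: emeasure_eq_measure)
  have one: "prob UNIV = 1" using prob_space by simp
  have const: "(\<integral>x. clamp_real a b x powr e \<partial>\<mu>) = a powr e" if "0 < a" for a b e :: real
  proof -
    have "(\<integral>x. clamp_real a b x powr e \<partial>\<mu>) = (\<integral>x. a powr e \<partial>\<mu>)"
      using AE that by (intro integral_cong_AE) (auto simp: clamp_real_below)
    then show ?thesis by (simp add: one)
  qed
  have "truncation_contractive p q 1 \<mu>"
    unfolding truncation_contractive_def using pq by (auto simp: const powr_powr)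
  then show ?thesis by (intro exI[of _ 1]) simp
qed

section \<open>Iterated maxima and minima\<close>

theorem theorem5p5:
  fixes M :: "'a measure" and X :: "'a \<Rightarrow> real" and p q :: real
  assumes "prob_space M"
    and "X \<in> borel_measurable M"
    and "AE \<omega> in M. 0 \<le> X \<omega>"
    and "0 < p" and "p < q"
    and "min_hypercontractive p q (distr M borel X)"
    and "max_hypercontractive p q (distr M borel X)"
  shows "\<exists>D::real. \<forall>nks :: (nat \<times> nat) list.
           nks \<noteq> [] \<and> (\<forall>(n, k) \<in> set nks. 1 \<le> n \<and> 1 \<le> k) \<longrightarrow>
           law_norm q (maxmin_law nks (distr M borel X)) \<le>
             D * law_norm p (maxmin_law nks (distr M borel X))"
proof -
  define \<mu> where "\<mu> = distr M borel X"
  interpret prob_space M by fact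
  have "real_distribution \<mu>" unfolding \<mu>_def by (rule real_distribution_distr) fact
  then interpret \<mu>: real_distribution \<mu> .
  have nn: "AE x in \<mu>. 0 \<le> x" and I: "integrable \<mu> (\<lambda>x. x powr q)"
    using assms(6) unfolding min_hypercontractive_def \<mu>_def by blast+
  have "integrable \<mu> (\<lambda>x. \<bar>x\<bar> powr q)"
    using I by (rule integrable_cong_AE_imp) (use nn in \<open>auto elim!: AE_mp\<close>)
  then have \<mu>: "moment_law q \<mu>"
    using nn \<mu>.real_distribution_axioms by (simp add: moment_law_def)
  obtain s where s: "0 < s" "truncation_contractive p q s \<mu>"
    using hypercontractive_imp_truncation_contractive[OF \<mu>] assms by (auto simp: \<mu>_def)
  have "law_norm q (maxmin_law nks \<mu>) \<le> 1 / s * law_norm p (maxmin_law nks \<mu>)"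
    if "\<forall>(n, k) \<in> set nks. 1 \<le> n \<and> 1 \<le> k" for nks
  proof -
    have "moment_law q (maxmin_law nks \<mu>) \<and> truncation_contractive p q s (maxmin_law nks \<mu>)"
      using maxmin_law_preserves[OF \<mu> _ _ s that] assms by simp
    then have "s * law_norm q (maxmin_law nks \<mu>) \<le> law_norm p (maxmin_law nks \<mu>)"
      using law_norm_le_of_truncation_contractive[of q _ p s] assms s by simp
    then show ?thesis using s by (simp add: field_simps)
  qed
  then show ?thesis unfolding \<mu>_def by blast
qed

end
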